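(* We have $D(\sigma)>0$ for all real $\sigma\le0$ and for all real $\sigma>1$, and $D(\sigma)\to-\infty$ as $\sigma\to1^{-}$ along the reals. Consequently, $D(\rho_0)=0$ for some $\rho_0\in(0,1)$; numerically, $\rho_0=0.200411339\cdots$.
   Context: Here $\zeta$ is the Riemann zeta function. $D$ is the function given by $D(s)=\sum_{n\ge1}\zeta(2n)\,n^{-s}$ for $\operatorname{Re}(s)>1$, continued meromorphically to $\mathbb{C}$ by $D(s)=\zeta(s)+E(s)$, where $E(s)=\sum_{n\ge1}(\zeta(2n)-1)n^{-s}$ converges absolutely for all $s\in\mathbb{C}$ and is entire; the only singularity of $D$ is a simple pole at $s=1$. $D$ is real on the real axis away from $s=1$. *)

theory Defs
  imports "HOL-Complex_Analysis.Complex_Analysis"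
begin

(* The analytic continuation of the Dirichlet series to the punctured plane. By the identity
   theorem it is unique away from 1, so only the (irrelevant) value at the pole depends on the
   choice made by SOME. *)
definition zeta :: "complex \<Rightarrow> complex" where
  "zeta = (SOME f. f holomorphic_on (- {1}) \<and>
             (\<forall>s. Re s > 1 \<longrightarrow> (\<lambda>n. of_nat (Suc n) powr (- s)) sums f s))"

(* The summation index n \<ge> 1 is written as Suc n. *)
definition E_fun :: "complex \<Rightarrow> complex" where
  "E_fun s = (\<Sum>n. (zeta (of_nat (2 * Suc n)) - 1) * of_nat (Suc n) powr (- s))"

(* For Re s > 1 this is the sum of zeta(2n) n^(-s) over n \<ge> 1; the sum zeta + E is its
   meromorphic continuation. The value at the pole s = 1 carries no meaning. *)
definition D_fun :: "complex \<Rightarrow> complex" where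
  "D_fun s = zeta s + E_fun s"

end

theory Submission imports Defs begin

text \<open>
  Expanding \<open>(n - 1/2) powr (1 - s) - (n + 1/2) powr (1 - s)\<close> binomially and summing over \<open>n\<close>
  gives, for \<open>L s = (s - 1) * \<zeta> s\<close>, the relation
  \[ \sum_{j \ge 0} {1 - s \choose 2j} \frac{L(s + 2j)}{4^j (2j + 1)} = 2^{s - 1}. \]
  It expresses \<open>L s\<close> by values further to the right, so it continues \<open>L\<close> to an entire function with
  \<open>L 1 = 1\<close>; hence \<open>D \<sigma>\<close> tends to minus infinity as \<open>\<sigma>\<close> increases to 1.
  At \<open>s = -a\<close> with \<open>a \<ge> 0\<close> the relation bounds \<open>\<bar>\<zeta> (-a)\<bar>\<close> inductively in terms of
  \<open>S a = (\<Sum>n. n powr a / 4 ^ n)\<close>, using \<open>a * (a - 1) * S (a - 2) \<le> 9 * S a\<close>, and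
  \<open>E (-a)\<close> exceeds that bound because \<open>\<zeta> (2 n) - 1 > 4 powr (- n)\<close>.
  The same relation with the first 16 terms of the zeta series removed converges fast enough to
  determine the signs of \<open>D\<close> at the two ends of the interval of length \<open>10 powr (-9)\<close>; the zero
  then comes from the intermediate value theorem.
\<close>

subsection \<open>The midpoint relation and the continuation of the zeta function\<close>

text \<open>Expanding around the midpoint cancels all even powers of the half step, so the relation
  shifts the argument by 2 and its coefficients are polynomials in s; neither Bernoulli numbers nor
  the functional equation enter. The factor s - 1 in L removes the pole, so the continuation meets
  no exceptional point. On the negative axis both quantities to be compared grow factorially:
  |zeta(-a)| at most roughly like Gamma(1 + a) / (2 pi)^a, and S a like Gamma(1 + a) / (log 4)^a.
  Since 2 pi is much larger than log 4, lossy constants are affordable. The 9 is 3^2, where 3 takes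
  the place of log 4 in a * S (a - 1) \<le> 3 * S a, and the induction closes because the sum over j
  \<ge> 1 of 9/4 * (9/4)^j / (2j + 1)! is below 1. What is left for small a is the margin 7/20 = 3/5
  - 1/4, a lower bound for zeta(2) - 1 - 1/4.\<close>

definition zeta_coeff :: "nat \<Rightarrow> 'a::field_char_0 \<Rightarrow> 'a" where
  "zeta_coeff j s = ((1 - s) gchoose (2 * j)) / (4 ^ j * of_nat (2 * j + 1))"

lemma zeta_coeff_0 [simp]: "zeta_coeff 0 s = 1"
  by (simp add: zeta_coeff_def)

text \<open>Signs, sizes, reality and holomorphy of the coefficients are all read off from this
  ratio by induction.\<close>

lemma zeta_coeff_Suc:
  "zeta_coeff (Suc j) s =
     zeta_coeff j s * ((s + of_nat (2 * j) - 1) * (s + of_nat (2 * j)) /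
       (4 * of_nat (2 * j + 2) * of_nat (2 * j + 3)))"
proof -
  have g: "((1 - s) gchoose (2 * Suc j)) = ((1 - s) gchoose (2 * j)) *
      ((s + of_nat (2 * j) - 1) * (s + of_nat (2 * j)) / (of_nat (2 * j + 1) * of_nat (2 * j + 2)))"
    by (simp add: gbinomial_prod_rev field_simps del: of_nat_Suc)
       (simp add: algebra_simps)
  have "(of_nat (2 * j + 1) :: 'a) \<noteq> 0" "(of_nat (2 * j + 2) :: 'a) \<noteq> 0" "(of_nat (2 * j + 3) :: 'a) \<noteq> 0"
    by (simp_all only: of_nat_eq_0_iff)
  thus ?thesis
    unfolding zeta_coeff_def g by (simp add: field_simps)
qed

lemma of_real_zeta_coeff: "of_real (zeta_coeff j x) = (zeta_coeff j (of_real x) :: complex)"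
  by (induction j) (simp_all add: zeta_coeff_Suc)

text \<open>Absorption: with a = 1 - s, the product of (a gchoose 2j) and (a - 2j) / (2j + 1) is the
  next binomial coefficient. Building \<open>zeta_coeff\<close> on the even coefficient avoids a
  division by s + 2j - 1, which may vanish.\<close>

lemma zeta_coeff_mult:
  "zeta_coeff j s * (s + of_nat (2 * j) - 1) = - (((1 - s) gchoose (2 * j + 1)) / 4 ^ j)"
proof -
  have "((1 - s) gchoose (2 * j + 1)) = ((1 - s) gchoose (2 * j)) * (1 - s - of_nat (2 * j)) / of_nat (2 * j + 1)"
    by (simp add: gbinomial_prod_rev)
  moreover have "(of_nat (2 * j + 1) :: 'a) \<noteq> 0" by (simp only: of_nat_eq_0_iff)
  moreover have "B / (F * C) * (- D) = - (B * D / C / F)" if "C \<noteq> 0" for B C D F :: 'a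
    using that by (simp add: field_simps)
  ultimately show ?thesis
    unfolding zeta_coeff_def by (metis minus_diff_eq diff_diff_eq2 add.commute)
qed

text \<open>The odd part of the binomial series of \<open>(n + h) powr (1 - s)\<close> at \<open>h = 1/2\<close>.\<close>
lemma midpoint_identity:
  fixes s :: complex
  assumes n: "n \<ge> (1::nat)"
  shows "(\<lambda>j. zeta_coeff j s * (s + of_nat (2 * j) - 1) * of_nat n powr (- (s + of_nat (2 * j))))
           sums (of_real (real n - 1/2) powr (1 - s) - of_real (real n + 1/2) powr (1 - s))"
proof -
  define f where "f = (\<lambda>k. ((1 - s) gchoose k) * of_nat n powr (1 - s - of_nat k) * ((1/2)^k - (-1/2)^k))"
  have p: "(\<lambda>k. ((1 - s) gchoose k) * of_nat n powr (1 - s - of_nat k) * (1/2)^k)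
      sums (of_real (real n + 1/2) powr (1 - s))"
    using gen_binomial_complex''[of "1/2" "real n" "1 - s"] n by simp
  have m: "(\<lambda>k. ((1 - s) gchoose k) * of_nat n powr (1 - s - of_nat k) * (-1/2)^k)
      sums (of_real (real n - 1/2) powr (1 - s))"
    using gen_binomial_complex''[of "-1/2" "real n" "1 - s"] n by simp
  have "f sums (of_real (real n + 1/2) powr (1 - s) - of_real (real n - 1/2) powr (1 - s))"
    using sums_diff[OF p m] by (simp add: f_def algebra_simps)
  moreover have "f k = 0" if "k \<notin> range (\<lambda>j. 2 * j + 1)" for k
  proof -
    have "even k" using that by (metis oddE rangeI)
    hence "(- (1/2)) ^ k = ((1/2) ^ k :: complex)" by (rule power_minus_even)
    thus ?thesis by (simp add: f_def)
  qed
  ultimately have "(\<lambda>j. f (2 * j + 1)) sums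
     (of_real (real n + 1/2) powr (1 - s) - of_real (real n - 1/2) powr (1 - s))"
    by (subst sums_mono_reindex[of "\<lambda>j. 2 * j + 1"]) (auto simp: strict_mono_def)
  moreover have "f (2 * j + 1) =
     - (zeta_coeff j s * (s + of_nat (2 * j) - 1) * of_nat n powr (- (s + of_nat (2 * j))))" for j
  proof -
    have "(1/2 :: complex)^(2 * j + 1) - (-1/2)^(2 * j + 1) = 1 / 4 ^ j"
    proof -
      have "(- (1/2) :: complex)^(2 * j + 1) = - ((1/2)^(2 * j + 1))"
        by (rule power_minus_odd) simp
      thus ?thesis by (simp add: power_mult power_divide)
    qed
    thus ?thesis unfolding f_def zeta_coeff_mult by simp
  qed
  ultimately show ?thesis
    using sums_minus by fastforce
qed

text \<open>The coefficient of y^k in (1 - y)^(-R). It bounds |a gchoose k| on the whole disc |a|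
  \<le> R and so yields majorants that are locally uniform in s.\<close>

definition gbinom_major :: "real \<Rightarrow> nat \<Rightarrow> real" where
  "gbinom_major R k = pochhammer R k / fact k"

lemma norm_gbinomial_le:
  fixes a :: complex
  assumes "norm a \<le> R"
  shows "norm (a gchoose k) \<le> gbinom_major R k"
proof -
  have "norm (pochhammer (- a) k) \<le> pochhammer R k"
  proof (induction k)
    case (Suc k)
    have "norm (- a + of_nat k) \<le> R + real k"
      using norm_triangle_ineq[of "- a" "of_nat k"] assms by simp
    with Suc have "norm (pochhammer (- a) k) * norm (- a + of_nat k) \<le> pochhammer R k * (R + real k)"
      by (intro mult_mono) (auto intro: order_trans[OF norm_ge_zero])
    thus ?case by (simp add: pochhammer_Suc norm_mult)
  qed simp
  thus ?thesis
    by (simp add: gbinomial_pochhammer norm_mult norm_divide norm_power gbinom_major_def divide_right_mono)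
qed

lemma summable_gbinom_major:
  assumes "\<bar>y\<bar> < 1"
  shows "summable (\<lambda>k. gbinom_major R k * y ^ k)"
proof -
  have "(\<lambda>k. ((- R) gchoose k) * (- y) ^ k) sums (1 + (- y)) powr (- R)"
    by (rule gen_binomial_real) (use assms in simp)
  moreover have "((- R) gchoose k) * (- y) ^ k = gbinom_major R k * y ^ k" for k
  proof -
    have "(- 1) ^ k * (- y) ^ k = y ^ k" by (simp flip: power_mult_distrib)
    thus ?thesis by (simp add: gbinomial_pochhammer gbinom_major_def field_simps)
  qed
  ultimately show ?thesis by (simp add: sums_iff)
qed

lemma gbinom_major_nonneg: "R \<ge> 0 \<Longrightarrow> gbinom_major R k \<ge> 0"
  by (auto simp: gbinom_major_def pochhammer_prod intro!: divide_nonneg_nonneg prod_nonneg)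

lemma summable_gbinom_major_subseq:
  assumes "R \<ge> 0"
  shows "summable (\<lambda>j. gbinom_major R (2 * j) / 4 ^ j)"
    and "summable (\<lambda>j. gbinom_major R (2 * j + 1) / 4 ^ j)"
proof -
  have s: "summable (\<lambda>k. norm (gbinom_major R k * (1/2) ^ k))"
    using summable_gbinom_major[of "1/2" R] gbinom_major_nonneg[OF assms] by simp
  have "summable (\<lambda>j. gbinom_major R (2 * j) * (1/2) ^ (2 * j))"
    using summable_reindex[OF summable_gbinom_major[of "1/2" R], of "\<lambda>j. 2 * j"] gbinom_major_nonneg[OF assms]
    by (simp add: inj_on_def o_def)
  thus "summable (\<lambda>j. gbinom_major R (2 * j) / 4 ^ j)"
    by (simp add: power_mult power_divide)
  have "summable (\<lambda>j. 2 * (gbinom_major R (2 * j + 1) * (1/2) ^ (2 * j + 1)))"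
    using summable_reindex[OF summable_gbinom_major[of "1/2" R], of "\<lambda>j. 2 * j + 1"] gbinom_major_nonneg[OF assms]
    by (intro summable_mult) (simp add: inj_on_def o_def)
  thus "summable (\<lambda>j. gbinom_major R (2 * j + 1) / 4 ^ j)"
    by (simp add: power_mult power_divide)
qed

text \<open>Fubini for absolutely convergent double series. A majorant of product form is enough
  here, since the terms split into a power of n and a binomial coefficient.\<close>

lemma sums_swap:
  fixes f :: "nat \<Rightarrow> nat \<Rightarrow> 'a::banach"
  assumes bound: "\<And>n j. norm (f n j) \<le> a n * b j"
    and a: "summable a" and b: "summable b"
    and a0: "\<And>n. a n \<ge> 0" and b0: "\<And>j. b j \<ge> 0"
    and rows: "\<And>n. f n sums r n" and cols: "\<And>j. (\<lambda>n. f n j) sums c j" and R: "r sums R"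
  shows "c sums R"
proof -
  have ab: "(\<lambda>(n, j). a n * b j) summable_on UNIV \<times> UNIV"
  proof (rule summable_on_SigmaI)
    show "((\<lambda>y. case (x, y) of (n, j) \<Rightarrow> a n * b j) has_sum (a x * suminf b)) UNIV" for x
    proof -
      have "(b has_sum suminf b) UNIV"
        using b b0 by (intro norm_summable_imp_has_sum summable_sums) auto
      thus ?thesis by (simp add: has_sum_cmult_right)
    qed
    show "(\<lambda>x. a x * suminf b) summable_on UNIV"
      by (intro norm_summable_imp_summable_on)
         (use a a0 b0 suminf_nonneg[OF b] in \<open>auto simp: abs_mult intro!: summable_mult2\<close>)
  qed (use a0 b0 in auto)
  have f: "(\<lambda>(n, j). f n j) summable_on UNIV \<times> UNIV"
    proof (rule abs_summable_summable, rule Infinite_Sum.abs_summable_on_comparison_test)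
    show "(\<lambda>p. norm (case p of (n, j) \<Rightarrow> a n * b j)) summable_on UNIV \<times> UNIV"
      using ab by (subst summable_on_iff_abs_summable_on_real [symmetric])
    show "norm (case p of (n, j) \<Rightarrow> f n j) \<le> norm (case p of (n, j) \<Rightarrow> a n * b j)" for p
      using bound a0 b0 by (auto split: prod.split simp: abs_mult)
  qed
  have fr: "(f n has_sum r n) UNIV" for n
  proof (rule norm_summable_imp_has_sum[OF _ rows])
    show "summable (\<lambda>j. norm (f n j))"
      by (rule summable_comparison_test'[of "\<lambda>j. a n * b j"]) (use bound b in \<open>auto intro: summable_mult\<close>)
  qed
  have fc: "((\<lambda>n. f n j) has_sum c j) UNIV" for j
  proof (rule norm_summable_imp_has_sum[OF _ cols])
    show "summable (\<lambda>n. norm (f n j))"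
      by (rule summable_comparison_test'[of "\<lambda>n. a n * b j"]) (use bound a in \<open>auto intro: summable_mult2\<close>)
  qed
  obtain S where S: "((\<lambda>(n, j). f n j) has_sum S) (UNIV \<times> UNIV)"
    using f by (auto simp: summable_on_def)
  have "(r has_sum S) UNIV"
    using has_sum_SigmaD[OF S] fr by auto
  hence "S = R" using R has_sum_imp_sums sums_unique2 by blast
  moreover have "((\<lambda>(j, n). f n j) has_sum S) (UNIV \<times> UNIV)"
    using S by (subst has_sum_swap) (simp add: case_prod_unfold)
  hence "(c has_sum S) UNIV"
    using has_sum_SigmaD fc by fastforce
  ultimately show ?thesis using has_sum_imp_sums by blast
qed

section \<open>The Dirichlet series on the half-plane Re s > 1\<close>

definition zeta_series :: "complex \<Rightarrow> complex" where
  "zeta_series s = (\<Sum>n. of_nat (Suc n) powr (- s))"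

lemma norm_of_nat_powr: "norm (of_nat (Suc n) powr (- s)) = real (Suc n) powr (- Re s)"
  using norm_powr_real_powr[of "of_nat (Suc n)" "- s"] by simp

lemma summable_Suc_powr: "x > 1 \<Longrightarrow> summable (\<lambda>n. real (Suc n) powr (- x))"
  by (subst summable_Suc_iff) (simp add: summable_real_powr_iff)

lemma summable_zeta_series: "Re s > 1 \<Longrightarrow> summable (\<lambda>n. of_nat (Suc n) powr (- s) :: complex)"
  by (rule summable_norm_cancel, unfold norm_of_nat_powr, rule summable_Suc_powr)

lemma zeta_series_sums: "Re s > 1 \<Longrightarrow> (\<lambda>n. of_nat (Suc n) powr (- s)) sums zeta_series s"
  unfolding zeta_series_def by (intro summable_sums summable_zeta_series)

text \<open>All but finitely many shifts s + 2j lie in this half-plane; a bound independent of j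
  there controls the tails of the relation.\<close>

lemma norm_zeta_series_le:
  assumes "Re s \<ge> 2"
  shows "norm (zeta_series s) \<le> (\<Sum>n. real (Suc n) powr (- 2))"
  unfolding zeta_series_def
proof (rule norm_suminf_le)
  fix n show "norm (of_nat (Suc n) powr (- s)) \<le> real (Suc n) powr (- 2)"
    unfolding norm_of_nat_powr by (rule powr_mono) (use assms in auto)
qed (rule summable_Suc_powr, simp)

lemma open_Re_greater: "open {s. Re s > c}"
  by (simp add: open_halfspace_Re_gt)

text \<open>Weierstrass M-test and locally uniform limits. The majorant is asked for almost all n
  only, because the first shifted arguments may lie outside the half-plane of the uniform
  bound.\<close>

lemma holomorphic_on_suminf:
  fixes f :: "nat \<Rightarrow> complex \<Rightarrow> complex"
  assumes "open S" and hol: "\<And>n. f n holomorphic_on S"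
    and bound: "\<And>x. x \<in> S \<Longrightarrow> \<exists>d>0. cball x d \<subseteq> S \<and>
        (\<exists>M. summable M \<and> eventually (\<lambda>n. \<forall>z\<in>cball x d. norm (f n z) \<le> M n) sequentially)"
  shows "(\<lambda>z. \<Sum>n. f n z) holomorphic_on S"
proof (rule holomorphic_uniform_sequence[OF assms(1)])
  show "(\<lambda>z. \<Sum>i<n. f i z) holomorphic_on S" for n
    by (intro holomorphic_intros hol)
  show "\<exists>d>0. cball x d \<subseteq> S \<and> uniform_limit (cball x d) (\<lambda>n z. \<Sum>i<n. f i z) (\<lambda>z. \<Sum>n. f n z) sequentially"
    if x: "x \<in> S" for x
  proof -
    obtain d M where "d > 0" "cball x d \<subseteq> S" "summable M"
      "eventually (\<lambda>n. \<forall>z\<in>cball x d. norm (f n z) \<le> M n) sequentially"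
      using bound[OF x] by blast
    thus ?thesis using Weierstrass_m_test_ev by blast
  qed
qed

lemma zeta_series_holomorphic: "zeta_series holomorphic_on {s. Re s > 1}"
  unfolding zeta_series_def
proof (rule holomorphic_on_suminf[OF open_Re_greater])
  show "(\<lambda>s. of_nat (Suc n) powr - s) holomorphic_on {s. 1 < Re s}" for n
    by (intro holomorphic_intros) (simp del: of_nat_Suc)
next
  fix x assume "x \<in> {s. 1 < Re s}"
  hence x: "Re x > 1" by simp
  define d where "d = (Re x - 1) / 2"
  have Re: "Re z \<ge> Re x - d" if "z \<in> cball x d" for z
    using that abs_Re_le_cmod[of "x - z"] by (simp add: dist_norm)
  have "norm (of_nat (Suc n) powr - z) \<le> real (Suc n) powr (- (Re x - d))" if "z \<in> cball x d" for n z
    unfolding norm_of_nat_powr by (rule powr_mono) (use Re[OF that] in auto)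
  moreover have "summable (\<lambda>n. real (Suc n) powr (- (Re x - d)))"
    by (rule summable_Suc_powr) (use x in \<open>simp add: d_def field_simps\<close>)
  moreover have "cball x d \<subseteq> {s. 1 < Re s}"
    using Re x by (force simp: d_def field_simps)
  moreover have "d > 0" using x by (simp add: d_def)
  ultimately show "\<exists>d>0. cball x d \<subseteq> {s. 1 < Re s} \<and> (\<exists>M. summable M \<and>
       (\<forall>\<^sub>F n in sequentially. \<forall>z\<in>cball x d. norm (of_nat (Suc n) powr - z) \<le> M n))"
    by (intro exI[of _ d] conjI exI[of _ "\<lambda>n. real (Suc n) powr (- (Re x - d))"] always_eventually) auto
qed

text \<open>The rows of the double series are midpoint identities, which telescope to (1/2)^(1 - s)
  because (n + 1/2)^(1 - s) tends to 0; its columns are Dirichlet series at s + 2j. Discarding the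
  decay n^(-2j) leaves a majorant of product form.\<close>

lemma zeta_series_relation:
  assumes s: "Re s > 1"
  shows "(\<lambda>j. zeta_coeff j s * ((s + of_nat (2 * j) - 1) * zeta_series (s + of_nat (2 * j))))
           sums ((1/2) powr (1 - s))"
proof -
  define f where "f = (\<lambda>n j. zeta_coeff j s * (s + of_nat (2 * j) - 1) * of_nat (Suc n) powr (- (s + of_nat (2 * j))))"
  define h where "h = (\<lambda>n. of_real (real n + 1/2) powr (1 - s))"
  define R where "R = norm (1 - s)"
  have "(\<lambda>j. zeta_coeff j s * (s + of_nat (2 * j) - 1) * zeta_series (s + of_nat (2 * j))) sums (h 0 - 0)"
  proof (rule sums_swap)
    show "norm (f n j) \<le> real (Suc n) powr (- Re s) * (gbinom_major R (2 * j + 1) / 4 ^ j)" for n j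
    proof -
      have "norm (f n j) = norm ((1 - s) gchoose (2 * j + 1)) / 4 ^ j * real (Suc n) powr (- Re s - 2 * real j)"
        unfolding f_def norm_mult norm_of_nat_powr by (subst norm_mult [symmetric], subst zeta_coeff_mult)
          (simp add: norm_divide norm_power)
      also have "\<dots> \<le> gbinom_major R (2 * j + 1) / 4 ^ j * real (Suc n) powr (- Re s)"
        by (intro mult_mono divide_right_mono norm_gbinomial_le powr_mono divide_nonneg_nonneg gbinom_major_nonneg)
           (auto simp: R_def)
      finally show ?thesis by (simp add: mult_ac)
    qed
    show "summable (\<lambda>j. gbinom_major R (2 * j + 1) / 4 ^ j)"
      by (rule summable_gbinom_major_subseq) (simp add: R_def)
    show "f n sums (h n - h (Suc n))" for n
      using midpoint_identity[of "Suc n" s] by (simp add: f_def h_def add_ac)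
    show "(\<lambda>n. f n j) sums (zeta_coeff j s * (s + of_nat (2 * j) - 1) * zeta_series (s + of_nat (2 * j)))" for j
      unfolding f_def using s by (intro sums_mult zeta_series_sums) simp
    have "(\<lambda>n. norm (h n)) \<longlonglongrightarrow> 0"
    proof -
      have "norm (h n) = (real n + 1/2) powr (1 - Re s)" for n
        unfolding h_def by (subst norm_powr_real_powr) auto
      moreover have "(\<lambda>n. (real n + 1/2) powr (1 - Re s)) \<longlonglongrightarrow> 0"
        by (intro tendsto_neg_powr filterlim_tendsto_add_at_top[OF tendsto_const filterlim_real_sequentially, of "1/2", simplified add.commute] )
           (use s in auto)
      ultimately show ?thesis by simp
    qed
    hence "h \<longlonglongrightarrow> 0" by (rule tendsto_norm_zero_cancel)
    thus "(\<lambda>n. h n - h (Suc n)) sums (h 0 - 0)" by (rule telescope_sums')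
  qed (use s in \<open>auto simp: R_def summable_Suc_powr simp del: of_nat_Suc intro!: divide_nonneg_nonneg gbinom_major_nonneg\<close>)
  thus ?thesis by (simp add: h_def mult.assoc)
qed

text \<open>The values at \<open>s + 2, s + 4, \<dots>\<close> determine the value at \<open>s\<close>, so every step continues
  \<open>(s - 1) \<zeta>(s)\<close> by two further units to the left.\<close>
fun zeta1_step :: "nat \<Rightarrow> complex \<Rightarrow> complex" where
  "zeta1_step 0 s = (s - 1) * zeta_series s"
| "zeta1_step (Suc k) s = (1/2) powr (1 - s) -
     (\<Sum>j. zeta_coeff (Suc j) s * zeta1_step k (s + of_nat (2 * Suc j)))"

text \<open>For k = 0 this is the relation solved for its term j = 0. For larger k the arguments s +
  2, s + 4, ... lie in the half-plane of the induction hypothesis, so both recursions sum the same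
  values.\<close>

lemma zeta1_step_Suc_agrees: "Re s > 1 - 2 * real k \<Longrightarrow> zeta1_step (Suc k) s = zeta1_step k s"
proof (induction k arbitrary: s)
  case 0
  hence "Re s > 1" by simp
  define f where "f = (\<lambda>j. zeta_coeff j s * ((s + of_nat (2 * j) - 1) * zeta_series (s + of_nat (2 * j))))"
  have "f sums ((1/2) powr (1 - s))"
    unfolding f_def by (rule zeta_series_relation) fact
  hence "(\<lambda>j. f (Suc j)) sums ((1/2) powr (1 - s) - f 0)"
    by (simp add: sums_Suc_iff)
  hence "(\<Sum>j. f (Suc j)) = (1/2) powr (1 - s) - f 0"
    by (rule sums_unique [symmetric])
  thus ?case by (simp add: f_def)
next
  case (Suc k)
  have "zeta1_step (Suc k) (s + of_nat (2 * Suc j)) = zeta1_step k (s + of_nat (2 * Suc j))" for j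
    by (rule Suc.IH) (use Suc.prems in simp)
  thus ?case by (simp del: of_nat_Suc zeta1_step.simps add: zeta1_step.simps(2))
qed

lemma zeta1_step_agrees: "k \<le> m \<Longrightarrow> Re s > 1 - 2 * real k \<Longrightarrow> zeta1_step m s = zeta1_step k s"
  by (induction m rule: dec_induct) (auto simp del: zeta1_step.simps simp: zeta1_step_Suc_agrees)

text \<open>At t = s + 2j with Re t \<ge> 2 every step function equals (t - 1) times the Dirichlet
  series, so the bound is uniform in k. The factor 2j + 1 from |t - 1| cancels the denominator of
  the coefficient.\<close>

lemma zeta1_step_term_bound:
  "\<exists>C\<ge>0. \<forall>s j k. Re s + 2 * real j \<ge> 2 \<longrightarrow>
     norm (zeta_coeff j s * zeta1_step k (s + of_nat (2 * j))) \<le> C * (1 + norm s) * (gbinom_major (1 + norm s) (2 * j) / 4 ^ j)"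
proof -
  define C where "C = (\<Sum>n. real (Suc n) powr (- 2))"
  have C: "C \<ge> 0" unfolding C_def by (intro suminf_nonneg summable_Suc_powr) auto
  have "norm (zeta_coeff j s * zeta1_step k (s + of_nat (2 * j))) \<le> C * (1 + norm s) * (gbinom_major (1 + norm s) (2 * j) / 4 ^ j)"
    if s: "Re s + 2 * real j \<ge> 2" for s j k
  proof -
    define t where "t = s + of_nat (2 * j)"
    have "zeta1_step k t = zeta1_step 0 t"
      by (rule zeta1_step_agrees) (use s in \<open>auto simp: t_def\<close>)
    hence "norm (zeta1_step k t) = norm (t - 1) * norm (zeta_series t)"
      by (simp add: norm_mult)
    also have "\<dots> \<le> ((1 + norm s) * (2 * real j + 1)) * C"
    proof (rule mult_mono)
      have "norm (t - 1) \<le> norm s + norm (of_nat (2 * j) :: complex) + 1"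
        unfolding t_def by (metis norm_triangle_ineq norm_triangle_ineq4 norm_one add_right_mono order_trans)
      also have "\<dots> \<le> (1 + norm s) * (2 * real j + 1)"
        by (simp add: algebra_simps)
      finally show "norm (t - 1) \<le> (1 + norm s) * (2 * real j + 1)" .
      show "norm (zeta_series t) \<le> C"
        unfolding C_def by (rule norm_zeta_series_le) (use s in \<open>simp add: t_def\<close>)
    qed auto
    finally have t: "norm (zeta1_step k t) \<le> ((1 + norm s) * (2 * real j + 1)) * C" .
    have "norm (zeta_coeff j s) \<le> gbinom_major (1 + norm s) (2 * j) / (4 ^ j * (2 * real j + 1))"
    proof -
      have "norm (1 - s) \<le> 1 + norm s"
        using norm_triangle_ineq4[of 1 s] by simp
      hence "norm ((1 - s) gchoose (2 * j)) \<le> gbinom_major (1 + norm s) (2 * j)"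
        by (rule norm_gbinomial_le)
      moreover have "real (2 * j + 1) = 2 * real j + 1" by simp
      ultimately show ?thesis
        unfolding zeta_coeff_def norm_divide norm_mult norm_power norm_of_nat norm_numeral
        by (metis (no_types) divide_right_mono mult_nonneg_nonneg of_nat_0_le_iff zero_le_numeral zero_le_power)
    qed
    hence "norm (zeta_coeff j s * zeta1_step k t) \<le>
       gbinom_major (1 + norm s) (2 * j) / (4 ^ j * (2 * real j + 1)) * (((1 + norm s) * (2 * real j + 1)) * C)"
      unfolding norm_mult using t by (intro mult_mono) (auto intro!: divide_nonneg_nonneg gbinom_major_nonneg)
    also have "\<dots> = C * (1 + norm s) * (gbinom_major (1 + norm s) (2 * j) / 4 ^ j)"
      by (simp add: divide_simps)
    finally show ?thesis by (simp add: t_def)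
  qed
  with C show ?thesis by blast
qed

lemma gbinom_major_mono: "0 \<le> R \<Longrightarrow> R \<le> R' \<Longrightarrow> gbinom_major R k \<le> gbinom_major R' k"
  unfolding gbinom_major_def pochhammer_prod by (intro divide_right_mono prod_mono) auto

lemma zeta_coeff_holomorphic: "zeta_coeff j holomorphic_on A"
  by (induction j) (auto simp: zeta_coeff_Suc [abs_def] intro!: holomorphic_intros simp del: of_nat_Suc)

lemma zeta1_step_holomorphic: "zeta1_step k holomorphic_on {s. Re s > 1 - 2 * real k}"
proof (induction k)
  case 0
  show ?case using zeta_series_holomorphic by (auto simp: fun_eq_iff intro!: holomorphic_intros)
next
  case (Suc k)
  let ?S = "{s. Re s > 1 - 2 * real (Suc k)}"
  have "(\<lambda>s. \<Sum>j. zeta_coeff (Suc j) s * zeta1_step k (s + of_nat (2 * Suc j))) holomorphic_on ?S"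
  proof (rule holomorphic_on_suminf[OF open_Re_greater])
    fix j
    have "zeta1_step k \<circ> (\<lambda>s. s + of_nat (2 * Suc j)) holomorphic_on ?S"
      by (rule holomorphic_on_compose_gen[OF _ Suc.IH]) (auto intro!: holomorphic_intros)
    thus "(\<lambda>s. zeta_coeff (Suc j) s * zeta1_step k (s + of_nat (2 * Suc j))) holomorphic_on ?S"
      by (intro holomorphic_on_mult zeta_coeff_holomorphic) (simp add: o_def)
  next
    fix x assume x: "x \<in> ?S"
    obtain d where d: "d > 0" "cball x d \<subseteq> ?S"
      using open_Re_greater x open_contains_cball by blast
    obtain C where C: "C \<ge> 0" and bd: "\<And>s j k. Re s + 2 * real j \<ge> 2 \<Longrightarrow>
      norm (zeta_coeff j s * zeta1_step k (s + of_nat (2 * j))) \<le> C * (1 + norm s) * (gbinom_major (1 + norm s) (2 * j) / 4 ^ j)"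
      using zeta1_step_term_bound by blast
    define B where "B = norm x + d"
    have B: "norm z \<le> B" if "z \<in> cball x d" for z
      using that norm_triangle_ineq2[of z x] by (simp add: B_def dist_norm norm_minus_commute)
    define M where "M = (\<lambda>j. C * (1 + B) * (gbinom_major (1 + B) (2 * Suc j) / 4 ^ Suc j))"
    have "B \<ge> 0" using d by (simp add: B_def)
    have "summable M"
      unfolding M_def
      by (intro summable_mult) (subst summable_Suc_iff, rule summable_gbinom_major_subseq, use \<open>B \<ge> 0\<close> in simp)
    \<comment> \<open>With j \<ge> B and Re z \<ge> -B the shifted point has real part at least 2,
      so the term bound applies.\<close>
    moreover have "norm (zeta_coeff (Suc j) z * zeta1_step k (z + of_nat (2 * Suc j))) \<le> M j"
      if j: "j \<ge> nat \<lceil>B\<rceil>" and z: "z \<in> cball x d" for j z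
    proof -
      have "- Re z \<le> B" using B[OF z] abs_Re_le_cmod[of z] by simp
      moreover have "real j \<ge> B" using j by linarith
      ultimately have "Re z + 2 * real (Suc j) \<ge> 2" by simp
      from bd[OF this] have "norm (zeta_coeff (Suc j) z * zeta1_step k (z + of_nat (2 * Suc j)))
        \<le> C * (1 + norm z) * (gbinom_major (1 + norm z) (2 * Suc j) / 4 ^ Suc j)" .
      also have "\<dots> \<le> M j"
        unfolding M_def using B[OF z] C \<open>B \<ge> 0\<close>
        by (intro mult_mono divide_right_mono gbinom_major_mono) (auto intro!: divide_nonneg_nonneg gbinom_major_nonneg mult_nonneg_nonneg)
      finally show ?thesis .
    qed
    hence "\<forall>\<^sub>F j in sequentially. \<forall>z\<in>cball x d.
       norm (zeta_coeff (Suc j) z * zeta1_step k (z + of_nat (2 * Suc j))) \<le> M j"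
      unfolding eventually_sequentially by blast
    ultimately show "\<exists>d>0. cball x d \<subseteq> ?S \<and> (\<exists>M. summable M \<and> (\<forall>\<^sub>F j in sequentially. \<forall>z\<in>cball x d.
       norm (zeta_coeff (Suc j) z * zeta1_step k (z + of_nat (2 * Suc j))) \<le> M j))"
      using d by blast
  qed
  thus ?case
    by (simp only: zeta1_step.simps(2) [abs_def]) (intro holomorphic_intros, auto)
qed

section \<open>The entire function L and its identification with the chosen zeta\<close>

definition zeta1 :: "complex \<Rightarrow> complex" where
  "zeta1 s = zeta1_step (nat \<lceil>\<bar>Re s\<bar>\<rceil> + 1) s"

text \<open>The number of steps in \<open>zeta1\<close> varies with s, but every sufficient number
  gives the same value. On a half-plane one fixed k therefore serves, and holomorphy carries
  over.\<close>

lemma zeta1_eq_step: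
  assumes "Re s > 1 - 2 * real k"
  shows "zeta1 s = zeta1_step k s"
proof -
  define m where "m = nat \<lceil>\<bar>Re s\<bar>\<rceil> + 1"
  have "real (nat \<lceil>\<bar>Re s\<bar>\<rceil>) \<ge> \<bar>Re s\<bar>" by linarith
  moreover have "real m = real (nat \<lceil>\<bar>Re s\<bar>\<rceil>) + 1" by (simp add: m_def)
  ultimately have m: "Re s > 1 - 2 * real m" by linarith
  show ?thesis
    using zeta1_step_agrees[of k m s] zeta1_step_agrees[of m k s] m assms
    by (cases "k \<le> m") (auto simp: zeta1_def m_def)
qed

lemma zeta1_holomorphic: "zeta1 holomorphic_on UNIV"
proof -
  have "zeta1 holomorphic_on (\<Union>k. {s. Re s > 1 - 2 * real k})"
  proof (rule holomorphic_on_UN_open)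
    show "zeta1 holomorphic_on {s. Re s > 1 - 2 * real k}" for k
      by (rule holomorphic_transform[OF zeta1_step_holomorphic[of k]]) (simp add: zeta1_eq_step)
  qed (rule open_Re_greater)
  moreover have "(\<Union>k. {s. Re s > 1 - 2 * real k}) = UNIV"
  proof -
    have "\<exists>k. Re s > 1 - 2 * real k" for s
    proof -
      obtain k :: nat where "real k > 1 - Re s" using reals_Archimedean2 by blast
      hence "Re s > 1 - 2 * real k" by linarith
      thus ?thesis ..
    qed
    thus ?thesis by auto
  qed
  ultimately show ?thesis by simp
qed

text \<open>For large k the recursion defining \<open>zeta1_step (Suc k)\<close> is this relation
  solved for its first term, and k steps already reach all shifted arguments.\<close>

lemma zeta1_sums: "(\<lambda>j. zeta_coeff j s * zeta1 (s + of_nat (2 * j))) sums ((1/2) powr (1 - s))"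
proof -
  obtain k :: nat where k: "real k > 1 - Re s" using reals_Archimedean2 by blast
  hence k': "Re s > 1 - 2 * real k" "Re s > 1 - 2 * real (Suc k)" by auto
  define f where "f = (\<lambda>j. zeta_coeff j s * zeta1_step k (s + of_nat (2 * j)))"
  have f: "f j = zeta_coeff j s * zeta1 (s + of_nat (2 * j))" for j
    using k' by (subst zeta1_eq_step[of k]) (auto simp: f_def)
  have "summable f"
  proof -
    obtain C where bd: "\<And>s j k. Re s + 2 * real j \<ge> 2 \<Longrightarrow>
      norm (zeta_coeff j s * zeta1_step k (s + of_nat (2 * j))) \<le> C * (1 + norm s) * (gbinom_major (1 + norm s) (2 * j) / 4 ^ j)"
      using zeta1_step_term_bound by blast
    have le: "norm (f j) \<le> C * (1 + norm s) * (gbinom_major (1 + norm s) (2 * j) / 4 ^ j)" if "j \<ge> k + 1" for j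
    proof -
      have "real j \<ge> real k + 1" using that by simp
      hence "Re s + 2 * real j \<ge> 2" using k by linarith
      from bd[OF this, of k] show ?thesis by (simp add: f_def)
    qed
    have "summable (\<lambda>j. C * (1 + norm s) * (gbinom_major (1 + norm s) (2 * j) / 4 ^ j))"
      by (rule summable_mult, rule summable_gbinom_major_subseq) simp
    thus ?thesis by (rule summable_comparison_test') (rule le)
  qed
  have "zeta1 s = zeta1_step (Suc k) s" by (rule zeta1_eq_step) (rule k'(2))
  also have "\<dots> = (1/2) powr (1 - s) - (\<Sum>j. f (Suc j))"
    unfolding f_def by (simp only: zeta1_step.simps)
  finally have "suminf f = (1/2) powr (1 - s)"
    using suminf_split_head[OF \<open>summable f\<close>] f[of 0] by simp
  with \<open>summable f\<close> have "f sums ((1/2) powr (1 - s))" by (metis summable_sums)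
  thus ?thesis by (simp only: f [abs_def])
qed

lemma zeta1_eq_series: "Re s > 1 \<Longrightarrow> zeta1 s = (s - 1) * zeta_series s"
  using zeta1_eq_step[of 0 s] by simp

lemma zeta_coeff_at_1: "zeta_coeff (Suc j) 1 = 0"
proof (induction j)
  case 0
  show ?case by (simp add: zeta_coeff_Suc)
next
  case (Suc j)
  thus ?case by (subst zeta_coeff_Suc) simp
qed

text \<open>Every coefficient with j \<ge> 1 has the factor s - 1, so at s = 1 the relation
  collapses to its first term. The value is the residue of zeta at 1.\<close>

lemma zeta1_1: "zeta1 1 = 1"
proof -
  have "(\<lambda>j. zeta_coeff j 1 * zeta1 (1 + of_nat (2 * j))) sums (\<Sum>j\<in>{0}. zeta_coeff j 1 * zeta1 (1 + of_nat (2 * j)))"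
    by (rule sums_finite) (auto simp: zeta_coeff_at_1 gr0_conv_Suc)
  from sums_unique2[OF this zeta1_sums] show ?thesis by simp
qed

text \<open>As zeta is given by a choice, nothing is known about it before a witness exists; L(s) /
  (s - 1) is that witness.\<close>

lemma zeta_spec:
  "zeta holomorphic_on (- {1}) \<and> (\<forall>s. Re s > 1 \<longrightarrow> (\<lambda>n. of_nat (Suc n) powr (- s)) sums zeta s)"
  unfolding zeta_def
proof (rule someI[of _ "\<lambda>s. zeta1 s / (s - 1)"], intro conjI allI impI)
  show "(\<lambda>s. zeta1 s / (s - 1)) holomorphic_on - {1}"
    by (intro holomorphic_intros holomorphic_on_subset[OF zeta1_holomorphic]) auto
  fix s :: complex assume s: "Re s > 1"
  hence "s \<noteq> 1" by auto
  thus "(\<lambda>n. of_nat (Suc n) powr (- s)) sums (zeta1 s / (s - 1))"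
    using zeta_series_sums[OF s] by (simp add: zeta1_eq_series[OF s])
qed

lemma zeta_eq: "s \<noteq> 1 \<Longrightarrow> zeta s = zeta1 s / (s - 1)"
proof (rule analytic_continuation_open[of "{s. Re s > 1}" "- {1}" zeta "\<lambda>s. zeta1 s / (s - 1)"])
  show "(\<lambda>s. zeta1 s / (s - 1)) holomorphic_on - {1}"
    by (intro holomorphic_intros holomorphic_on_subset[OF zeta1_holomorphic]) auto
  show "zeta holomorphic_on - {1}" using zeta_spec by blast
  show "{s. Re s > 1} \<noteq> {}" by (auto intro: exI[of _ 2])
  show "connected (- {1::complex})" by (rule connected_punctured_universe) simp
  show "zeta s = zeta1 s / (s - 1)" if "s \<in> {s. 1 < Re s}" for s
  proof -
    have s: "Re s > 1" "s \<noteq> 1" using that by auto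
    have "zeta s = zeta_series s"
      using zeta_spec zeta_series_sums s sums_unique2 by blast
    thus ?thesis using s by (simp add: zeta1_eq_series)
  qed
qed (auto simp: open_Re_greater)

section \<open>Restriction to the real line and values at even integers\<close>

lemma sums_in_Reals:
  fixes f :: "nat \<Rightarrow> complex"
  assumes "f sums S" "\<And>n. f n \<in> \<real>"
  shows "S \<in> \<real>"
  using sums_Im[OF assms(1)] assms(2) sums_unique2[of "\<lambda>n. 0" 0 "Im S"]
  by (simp add: complex_is_Real_iff)

lemma of_real_powr_real: "x > 0 \<Longrightarrow> of_real x powr of_real y = (of_real (x powr y) :: complex)"
  by (simp add: powr_of_real)

text \<open>Reality moves to the left two units at a time: in the relation the right side, the
  coefficients and the values at x + 2, x + 4, ... are real, hence so is the remaining term.\<close>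

lemma zeta1_real: "zeta1 (of_real x) \<in> \<real>"
proof -
  have "zeta1 (of_real x) \<in> \<real>" if "x > 1 - 2 * real k" for k x
    using that
  proof (induction k arbitrary: x)
    case 0
    hence x: "x > 1" by simp
    have "of_nat (Suc n) powr (- of_real x) = (of_real (real (Suc n) powr (- x)) :: complex)" for n
      using of_real_powr_real[of "real (Suc n)" "- x"] by simp
    hence "zeta_series (of_real x) \<in> \<real>"
      using x by (intro sums_in_Reals[OF zeta_series_sums]) auto
    thus ?case using x by (simp add: zeta1_eq_series)
  next
    case (Suc k)
    define f where "f = (\<lambda>j. zeta_coeff j (of_real x) * zeta1 (of_real x + of_nat (2 * j)))"
    have "(\<lambda>j. f (Suc j)) sums ((1/2) powr (1 - of_real x) - f 0)"
      unfolding sums_Suc_iff using zeta1_sums[of "of_real x"] by (simp add: f_def)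
    moreover have "f (Suc j) \<in> \<real>" for j
    proof -
      have "zeta1 (of_real (x + of_nat (2 * Suc j))) \<in> \<real>"
        by (rule Suc.IH) (use Suc.prems in simp)
      thus ?thesis unfolding f_def by (simp add: of_real_zeta_coeff [symmetric])
    qed
    ultimately have "(1/2) powr (1 - of_real x) - f 0 \<in> \<real>"
      by (rule sums_in_Reals)
    moreover have "(1/2) powr (1 - of_real x) = (of_real ((1/2) powr (1 - x)) :: complex)"
      using of_real_powr_real[of "1/2" "1 - x"] by simp
    ultimately have "of_real ((1/2) powr (1 - x)) - ((of_real ((1/2) powr (1 - x)) :: complex) - f 0) \<in> \<real>"
      by (metis Reals_diff Reals_of_real)
    thus ?case by (simp add: f_def)
  qed
  moreover obtain k :: nat where "real k > 1 - x" using reals_Archimedean2 by blast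
  hence "x > 1 - 2 * real k" by linarith
  ultimately show ?thesis by blast
qed

definition zeta1_re :: "real \<Rightarrow> real" where "zeta1_re x = Re (zeta1 (of_real x))"

lemma of_real_zr: "of_real (zeta1_re x) = zeta1 (of_real x)"
  using zeta1_real[of x] by (simp add: zeta1_re_def)

lemma zeta1_re_1: "zeta1_re 1 = 1"
  by (simp add: zeta1_re_def zeta1_1)

lemma zeta1_re_sums: "(\<lambda>j. zeta_coeff j x * zeta1_re (x + of_nat (2 * j))) sums ((1/2) powr (1 - x))"
proof -
  have "(\<lambda>j. complex_of_real (zeta_coeff j x * zeta1_re (x + of_nat (2 * j)))) sums of_real ((1/2) powr (1 - x))"
    using zeta1_sums[of "of_real x"] of_real_powr_real[of "1/2" "1 - x"]
    by (simp add: of_real_zr of_real_zeta_coeff)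
  thus ?thesis by (simp only: sums_of_real_iff)
qed

lemma zeta1_re_series: "x > 1 \<Longrightarrow> (\<lambda>n. real (Suc n) powr (- x)) sums (zeta1_re x / (x - 1))"
proof -
  assume x: "x > 1"
  have "(\<lambda>n. complex_of_real (real (Suc n) powr (- x))) sums of_real (zeta1_re x / (x - 1))"
  proof -
    have "of_nat (Suc n) powr (- of_real x) = (of_real (real (Suc n) powr (- x)) :: complex)" for n
      using of_real_powr_real[of "real (Suc n)" "- x"] by simp
    thus ?thesis
      using zeta_series_sums[of "of_real x"] x by (simp add: of_real_zr zeta1_eq_series)
  qed
  thus ?thesis by (simp only: sums_of_real_iff)
qed

lemma continuous_on_zr: "continuous_on A zeta1_re"
proof -
  have "continuous_on UNIV zeta1"
    by (rule holomorphic_on_imp_continuous_on[OF zeta1_holomorphic])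
  hence "continuous_on A (\<lambda>x. zeta1 (of_real x))"
    by (rule continuous_on_compose2) (auto intro: continuous_intros)
  thus ?thesis unfolding zeta1_re_def by (intro continuous_intros)
qed

text \<open>The number zeta(2n + 2) - 1, indexed from 0 like the sum in
  \<open>E_fun\<close>.\<close>

definition zeta_excess :: "nat \<Rightarrow> real" where
  "zeta_excess n = (\<Sum>k. real (k + 2) powr (- real (2 * Suc n)))"

lemma zeta_excess_sums: "(\<lambda>k. real (k + 2) powr (- real (2 * Suc n))) sums zeta_excess n"
  unfolding zeta_excess_def
  by (rule summable_sums, subst summable_iff_shift) (simp add: summable_real_powr_iff)

lemma zeta_of_real:
  assumes "x \<noteq> 1"
  shows "zeta (of_real x) = of_real (zeta1_re x / (x - 1))"
proof -
  have "complex_of_real x \<noteq> 1" using assms by simp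
  from zeta_eq[OF this] show ?thesis by (simp add: of_real_zr)
qed

lemma zeta_excess_eq:
  assumes x: "x = real (2 * Suc n)"
  shows "zeta1_re x / (x - 1) = zeta_excess n + 1"
proof -
  define f where "f = (\<lambda>k. real (Suc k) powr (- x))"
  have "f sums (zeta1_re x / (x - 1))"
    unfolding f_def by (rule zeta1_re_series) (simp add: x)
  hence "(\<lambda>k. f (Suc k)) sums (zeta1_re x / (x - 1) - 1)"
  proof -
    have "f 0 = 1" by (simp add: f_def)
    thus ?thesis using \<open>f sums _\<close> by (subst sums_Suc_iff) simp
  qed
  hence "(\<lambda>k. real (k + 2) powr (- x)) sums (zeta1_re x / (x - 1) - 1)"
    by (simp add: f_def add_ac)
  hence "zeta1_re x / (x - 1) - 1 = zeta_excess n"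
    unfolding x by (rule sums_unique2[OF _ zeta_excess_sums])
  thus ?thesis by simp
qed

lemma zeta_even: "zeta (of_nat (2 * Suc n)) - 1 = of_real (zeta_excess n)"
proof -
  define x where "x = real (2 * Suc n)"
  have "zeta (of_real x) = of_real (zeta1_re x / (x - 1))"
    by (rule zeta_of_real) (simp add: x_def)
  moreover have "complex_of_real x = of_nat (2 * Suc n)"
    unfolding x_def by (rule of_real_of_nat_eq)
  ultimately have "zeta (of_nat (2 * Suc n)) = of_real (zeta1_re x / (x - 1))" by simp
  also have "zeta1_re x / (x - 1) = zeta_excess n + 1"
    by (rule zeta_excess_eq) (rule x_def)
  finally show ?thesis by simp
qed

lemma zeta_excess_nonneg: "zeta_excess n \<ge> 0"
  unfolding zeta_excess_def
  by (rule suminf_nonneg) (use zeta_excess_sums[of n] in \<open>auto simp: sums_iff\<close>)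

text \<open>Raising the exponent by 2 divides each term by the square of its base, which is at least
  4. The geometric decay makes E converge at every argument.\<close>

lemma zeta_excess_Suc_le: "zeta_excess (Suc n) \<le> zeta_excess n / 4"
proof (rule sums_le[OF _ zeta_excess_sums sums_divide[OF zeta_excess_sums]])
  fix k
  have "real (k + 2) powr - real (2 * Suc (Suc n)) = real (k + 2) powr - real (2 * Suc n) / real (k + 2) ^ 2"
  proof -
    have "- real (2 * Suc (Suc n)) = - real (2 * Suc n) - 2" by simp
    thus ?thesis by (simp only: powr_diff) (simp add: powr_numeral)
  qed
  also have "\<dots> \<le> real (k + 2) powr - real (2 * Suc n) / 4"
  proof (rule divide_left_mono)
    have "(2::real) ^ 2 \<le> real (k + 2) ^ 2" by (intro power_mono) auto
    thus "4 \<le> real (k + 2) ^ 2" by simp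
  qed auto
  finally show "real (k + 2) powr - real (2 * Suc (Suc n)) \<le> real (k + 2) powr - real (2 * Suc n) / 4" .
qed

lemma zeta_excess_shift_le: "zeta_excess (n + m) \<le> zeta_excess n / 4 ^ m"
proof (induction m)
  case (Suc m)
  have "zeta_excess (n + Suc m) \<le> zeta_excess (n + m) / 4"
    using zeta_excess_Suc_le[of "n + m"] by simp
  also have "\<dots> \<le> (zeta_excess n / 4 ^ m) / 4"
    by (rule divide_right_mono[OF Suc]) simp
  finally show ?case by (simp add: mult.commute)
qed simp

section \<open>The series E on the real line\<close>

definition E_re :: "real \<Rightarrow> real" where
  "E_re x = (\<Sum>n. zeta_excess n * real (Suc n) powr (- x))"

text \<open>The power (n + 1)^m is at most the rising factorial (n + 1)...(n + m), which is m! times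
  the coefficient of y^n in (1 - y)^(-(m + 1)); so the binomial majorant applies again.\<close>

lemma summable_power_powr:
  assumes "\<bar>q\<bar> < 1"
  shows "summable (\<lambda>n. q ^ n * real (Suc n) powr a)"
proof -
  obtain m :: nat where m: "real m > a" using reals_Archimedean2 by blast
  have "summable (\<lambda>n. gbinom_major (real (Suc m)) n * fact m * \<bar>q\<bar> ^ n)"
    using summable_mult2[OF summable_gbinom_major[of "\<bar>q\<bar>" "real (Suc m)"], of "fact m"] assms
    by (simp add: mult_ac)
  moreover have "norm (q ^ n * real (Suc n) powr a) \<le> gbinom_major (real (Suc m)) n * fact m * \<bar>q\<bar> ^ n" for n
  proof -
    have "real (Suc n) powr a \<le> real (Suc n) ^ m"
      using m powr_mono[of a "real m" "real (Suc n)"] by (simp add: powr_realpow)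
    also have "\<dots> \<le> pochhammer (real (Suc n)) m"
    proof -
      have "(\<Prod>i<m. real (Suc n)) \<le> (\<Prod>i<m. real (Suc n) + real i)"
        by (intro prod_mono) auto
      thus ?thesis by (simp add: pochhammer_prod atLeast0LessThan)
    qed
    also have "\<dots> = fact (n + m) / fact n"
      using pochhammer_product'[of "1::real" n m]
      unfolding pochhammer_fact [symmetric] by (simp add: field_simps)
    also have "\<dots> = gbinom_major (real (Suc m)) n * fact m"
      using pochhammer_product'[of "1::real" m n]
      unfolding pochhammer_fact [symmetric] gbinom_major_def by (simp add: field_simps)
    finally have "real (Suc n) powr a * \<bar>q\<bar> ^ n \<le> gbinom_major (real (Suc m)) n * fact m * \<bar>q\<bar> ^ n"
      by (rule mult_right_mono) simp
    moreover have "norm (q ^ n * real (Suc n) powr a) = real (Suc n) powr a * \<bar>q\<bar> ^ n"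
      by (simp add: abs_mult power_abs)
    ultimately show ?thesis by simp
  qed
  ultimately show ?thesis by (rule summable_comparison_test')
qed

lemma E_re_sums: "(\<lambda>n. zeta_excess n * real (Suc n) powr (- x)) sums E_re x"
  unfolding E_re_def
proof (rule summable_sums, rule summable_comparison_test'[of "\<lambda>n. zeta_excess 0 * ((1/4) ^ n * real (Suc n) powr (- x))" 0])
  show "norm (zeta_excess n * real (Suc n) powr - x) \<le> zeta_excess 0 * ((1/4) ^ n * real (Suc n) powr - x)" for n
  proof -
    have "zeta_excess n * real (Suc n) powr - x \<le> zeta_excess 0 / 4 ^ n * real (Suc n) powr - x"
      using zeta_excess_shift_le[of 0 n] by (intro mult_right_mono) auto
    thus ?thesis using zeta_excess_nonneg[of n] by (simp add: abs_mult power_divide del: of_nat_Suc)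
  qed
  show "summable (\<lambda>n. zeta_excess 0 * ((1/4) ^ n * real (Suc n) powr (- x)))"
    by (rule summable_mult, rule summable_power_powr) simp
qed

lemma D_fun_of_real:
  assumes "x \<noteq> 1"
  shows "D_fun (of_real x) = of_real (zeta1_re x / (x - 1) + E_re x)"
proof -
  have "(zeta (of_nat (2 * Suc n)) - 1) * of_nat (Suc n) powr (- of_real x) =
      (of_real (zeta_excess n * real (Suc n) powr (- x)) :: complex)" for n
    using of_real_powr_real[of "real (Suc n)" "- x"] unfolding zeta_even by simp
  hence "E_fun (of_real x) = of_real (E_re x)"
    using sums_of_real[OF E_re_sums[of x], where 'a = complex] unfolding E_fun_def
    by (simp add: sums_iff)
  thus ?thesis using zeta_of_real[OF assms] by (simp add: D_fun_def)
qed

subsection \<open>Tails of the zeta series on the real line\<close>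

text \<open>For x > 1 this is x - 1 times the sum of n^(-x) over n \<ge> N; subtracting finitely
  many terms from L keeps it meaningful for every real x.\<close>

definition zeta1_tail :: "nat \<Rightarrow> real \<Rightarrow> real" where
  "zeta1_tail N x = zeta1_re x - (x - 1) * (\<Sum>n=1..<N. real n powr (- x))"

lemma zeta1_tail_1: "zeta1_tail (Suc 0) x = zeta1_re x"
  by (simp add: zeta1_tail_def)

lemma zeta1_tail_Suc: "N \<ge> 1 \<Longrightarrow> zeta1_tail (Suc N) x = zeta1_tail N x - (x - 1) * real N powr (- x)"
  by (simp add: zeta1_tail_def algebra_simps)

lemma midpoint_identity_real:
  assumes n: "n \<ge> (1::nat)"
  shows "(\<lambda>j. zeta_coeff j x * (x + of_nat (2 * j) - 1) * real n powr (- (x + of_nat (2 * j))))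
           sums ((real n - 1/2) powr (1 - x) - (real n + 1/2) powr (1 - x))"
proof -
  have eq: "complex_of_real (zeta_coeff j x * (x + of_nat (2 * j) - 1) * real n powr (- (x + of_nat (2 * j)))) =
     zeta_coeff j (of_real x) * (of_real x + of_nat (2 * j) - 1) * of_nat n powr (- (of_real x + of_nat (2 * j)))" for j
    using n of_real_powr_real[of "real n" "- (x + of_nat (2 * j))"]
    by (simp add: of_real_zeta_coeff)
  have "(\<lambda>j. complex_of_real (zeta_coeff j x * (x + of_nat (2 * j) - 1) * real n powr (- (x + of_nat (2 * j)))))
     sums of_real ((real n - 1/2) powr (1 - x) - (real n + 1/2) powr (1 - x))"
    unfolding eq
    using midpoint_identity[OF n, of "of_real x"] n of_real_powr_real[of "real n - 1/2" "1 - x"]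
      of_real_powr_real[of "real n + 1/2" "1 - x"] by simp
  thus ?thesis by (simp only: sums_of_real_iff)
qed

text \<open>Removing the term n = N subtracts the midpoint identity at N and moves the right side
  from N - 1/2 to N + 1/2. The coefficients stay the same while the tails at x + 2j shrink like (N -
  1/2)^(-2j), which is what speeds up convergence.\<close>

lemma zeta1_tail_sums:
  assumes "N \<ge> 1"
  shows "(\<lambda>j. zeta_coeff j x * zeta1_tail N (x + of_nat (2 * j))) sums ((real N - 1/2) powr (1 - x))"
  using assms
proof (induction N rule: dec_induct)
  case base
  show ?case using zeta1_re_sums[of x] by (simp add: zeta1_tail_1)
next
  case (step N)
  have "zeta_coeff j x * zeta1_tail (Suc N) (x + of_nat (2 * j)) =
      zeta_coeff j x * zeta1_tail N (x + of_nat (2 * j)) -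
      zeta_coeff j x * (x + of_nat (2 * j) - 1) * real N powr (- (x + of_nat (2 * j)))" for j
    unfolding zeta1_tail_Suc[OF step.hyps(1)] by (simp add: algebra_simps)
  moreover have "real (Suc N) - 1/2 = real N + 1/2" by simp
  ultimately show ?case
    using sums_diff[OF step.IH midpoint_identity_real[OF step.hyps(1), of x]] by (simp add: add.commute)
qed

lemma zeta1_tail_nonneg:
  assumes "x > 1"
  shows "zeta1_tail N x \<ge> 0"
proof -
  have "(\<Sum>n<N - 1. real (Suc n) powr (- x)) \<le> zeta1_re x / (x - 1)"
    using zeta1_re_series[OF assms] sum_le_suminf[of "\<lambda>n. real (Suc n) powr (- x)" "{..<N - 1}"]
    by (auto simp: sums_iff)
  moreover have "(\<Sum>n<N - 1. real (Suc n) powr (- x)) = (\<Sum>n=1..<N. real n powr (- x))"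
    by (rule sum.reindex_bij_witness[of _ "\<lambda>n. n - 1" Suc]) auto
  ultimately have "(x - 1) * (\<Sum>n=1..<N. real n powr (- x)) \<le> (x - 1) * (zeta1_re x / (x - 1))"
    using assms by (intro mult_left_mono) auto
  thus ?thesis using assms by (simp add: zeta1_tail_def)
qed

lemma zeta_coeff_nonneg: "x \<ge> (1::real) \<Longrightarrow> zeta_coeff j x \<ge> 0"
  by (induction j) (auto simp: zeta_coeff_Suc intro!: mult_nonneg_nonneg divide_nonneg_nonneg)

text \<open>All terms of the relation are nonnegative for x > 1, so the first is at most the sum.
  This is the comparison of the tail with the integral of t^(-x) from N - 1/2.\<close>

lemma zeta1_tail_le:
  assumes "x > 1" "N \<ge> 1"
  shows "zeta1_tail N x \<le> (real N - 1/2) powr (1 - x)"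
proof -
  define f where "f = (\<lambda>j. zeta_coeff j x * zeta1_tail N (x + of_nat (2 * j)))"
  have f: "f sums ((real N - 1/2) powr (1 - x))"
    unfolding f_def by (rule zeta1_tail_sums) fact
  have "f j \<ge> 0" for j
    unfolding f_def using assms by (intro mult_nonneg_nonneg zeta_coeff_nonneg zeta1_tail_nonneg) auto
  hence "sum f {0} \<le> suminf f"
    using f by (intro sum_le_suminf) (auto simp: sums_iff)
  thus ?thesis using f by (simp add: sums_iff f_def)
qed

text \<open>The term n = 1 contributes x - 1, and the tail from 2 is at most (3/2)^(1 - x) \<le>
  1.\<close>

lemma zeta1_re_le: "x > 1 \<Longrightarrow> zeta1_re x \<le> x"
proof -
  assume x: "x > 1"
  have "zeta1_tail (Suc 1) x = zeta1_re x - (x - 1)"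
    by (subst zeta1_tail_Suc) (simp_all add: zeta1_tail_1)
  moreover have "(real (Suc 1) - 1/2) powr (1 - x) \<le> (3/2) powr 0"
    by (simp only: of_nat_Suc) (use x powr_mono[of "1 - x" 0 "3/2"] in simp)
  ultimately show ?thesis using zeta1_tail_le[OF x, of "Suc 1"] by simp
qed

text \<open>On [0, 1] the only negative factor is x - 1 in the first ratio. The later ratios are
  largest at x = 1, where their product telescopes.\<close>

lemma zeta_coeff_unit_bounds:
  assumes "0 \<le> x" "x \<le> (1::real)"
  shows "zeta_coeff (Suc j) x \<le> 0"
    and "- zeta_coeff (Suc j) x \<le> x * (1 - x) / (real (2 * j + 2) * real (2 * j + 3) * 4 ^ Suc j)"
proof (induction j)
  case 0
  {
    case 1
    show ?case using assms by (simp add: zeta_coeff_Suc mult_nonneg_nonpos2 divide_nonpos_pos)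
  next
    case 2
    show ?case by (simp add: zeta_coeff_Suc field_simps)
  }
next
  case (Suc j)
  define r where "r = (x + of_nat (2 * Suc j) - 1) * (x + of_nat (2 * Suc j)) / (4 * of_nat (2 * Suc j + 2) * of_nat (2 * Suc j + 3))"
  have eq: "zeta_coeff (Suc (Suc j)) x = zeta_coeff (Suc j) x * r"
    unfolding r_def by (rule zeta_coeff_Suc)
  have r0: "r \<ge> 0" unfolding r_def using assms by (intro divide_nonneg_nonneg mult_nonneg_nonneg) auto
  {
    case 1
    show ?case unfolding eq using Suc(1) r0 by (rule mult_nonpos_nonneg)
  next
    case 2
    have r: "r \<le> real (2 * j + 2) * real (2 * j + 3) / (4 * real (2 * j + 4) * real (2 * j + 5))"
      unfolding r_def using assms by (intro frac_le mult_mono) auto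
    have "- zeta_coeff (Suc (Suc j)) x = (- zeta_coeff (Suc j) x) * r" by (simp add: eq)
    also have "\<dots> \<le> x * (1 - x) / (real (2 * j + 2) * real (2 * j + 3) * 4 ^ Suc j) *
        (real (2 * j + 2) * real (2 * j + 3) / (4 * real (2 * j + 4) * real (2 * j + 5)))"
      using Suc(2) r r0 assms by (intro mult_mono) auto
    also have "\<dots> = x * (1 - x) / (real (2 * Suc j + 2) * real (2 * Suc j + 3) * 4 ^ Suc (Suc j))"
    proof -
      have "A / (B * C * D) * (B * C / (4 * E * F)) = A / (E * F * (4 * D))"
        if "B \<noteq> 0" "C \<noteq> 0" for A B C D E F :: real
        using that by (simp add: field_simps)
      from this[of "real (2 * j + 2)" "real (2 * j + 3)" "x * (1 - x)" "4 ^ Suc j" "real (2 * j + 4)" "real (2 * j + 5)"]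
      show ?thesis by (simp add: algebra_simps)
    qed
    finally show ?case .
  }
qed

lemma sums_quarter: "(\<lambda>j. (1/4 :: real) ^ Suc j) sums (1/3)"
  using sums_mult[OF geometric_sums[of "1/4 :: real"], of "1/4"] by simp

text \<open>On (0, 1] the values at x + 2, x + 4, ... are covered by the case x > 1 and their
  coefficients are nonpositive. Hence L(x) is (1/2)^(1 - x) plus a quantity between 0 and
  x/3.\<close>

lemma zeta1_re_bounds:
  assumes "x > 0"
  shows "0 \<le> zeta1_re x" "zeta1_re x \<le> 1 + x"
proof -
  have "0 \<le> zeta1_re x \<and> zeta1_re x \<le> 1 + x"
  proof (cases "x > 1")
    case True
    thus ?thesis using zeta1_re_le[OF True] zeta1_tail_nonneg[OF True, of "Suc 0"] by (simp add: zeta1_tail_1)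
  next
    case False
    hence x: "0 \<le> x" "x \<le> 1" using assms by auto
    define f where "f = (\<lambda>j. zeta_coeff j x * zeta1_re (x + of_nat (2 * j)))"
    have f: "(\<lambda>j. - f (Suc j)) sums (- ((1/2) powr (1 - x) - f 0))"
      by (rule sums_minus, subst sums_Suc_iff) (use zeta1_re_sums[of x] in \<open>simp add: f_def\<close>)
    have zeta1_re: "0 \<le> zeta1_re (x + of_nat (2 * Suc j))" "zeta1_re (x + of_nat (2 * Suc j)) \<le> real (2 * j + 3)" for j
      using zeta1_re_le[of "x + of_nat (2 * Suc j)"] zeta1_tail_nonneg[of "x + of_nat (2 * Suc j)" "Suc 0"] x
      by (auto simp: zeta1_tail_1)
    have nn: "0 \<le> - f (Suc j)" for j
      unfolding f_def using mult_nonpos_nonneg[OF zeta_coeff_unit_bounds(1)[OF x] zeta1_re(1)] by simp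
    have "- f (Suc j) \<le> x * (1/4) ^ Suc j" for j
    proof -
      have "- f (Suc j) = (- zeta_coeff (Suc j) x) * zeta1_re (x + of_nat (2 * Suc j))" by (simp add: f_def)
      also have "\<dots> \<le> x * (1 - x) / (real (2 * j + 2) * real (2 * j + 3) * 4 ^ Suc j) * real (2 * j + 3)"
        using x by (intro mult_mono zeta1_re zeta_coeff_unit_bounds) auto
      also have "\<dots> = x * ((1 - x) / real (2 * j + 2)) * (1/4) ^ Suc j"
        by (simp add: power_divide divide_simps del: of_nat_Suc of_nat_add of_nat_mult)
      also have "\<dots> \<le> x * 1 * (1/4) ^ Suc j"
        using x by (intro mult_mono mult_left_mono) auto
      finally show ?thesis by simp
    qed
    hence "- ((1/2) powr (1 - x) - f 0) \<le> x * (1/3)"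
      by (rule sums_le[OF _ f sums_mult[OF sums_quarter]])
    moreover have "0 \<le> - ((1/2) powr (1 - x) - f 0)"
      using nn by (intro sums_le[OF _ sums_zero f])
    moreover have "(1/2) powr (1 - x) \<le> (1::real)" using x by (intro powr_le1) auto
    moreover have "(1/2) powr (1 - x) > (0::real)" by simp
    moreover have "f 0 = zeta1_re x" by (simp add: f_def)
    ultimately show ?thesis using x by (intro conjI; linarith)
  qed
  thus "0 \<le> zeta1_re x" "zeta1_re x \<le> 1 + x" by auto
qed

lemma abs_gbinomial_unit: "0 \<le> a \<Longrightarrow> a \<le> 1 \<Longrightarrow> \<bar>a gchoose m\<bar> \<le> (1::real)"
proof (induction m)
  case (Suc m)
  have "a gchoose Suc m = (a gchoose m) * ((a - real m) / real (Suc m))"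
    by (simp add: gbinomial_prod_rev)
  moreover have "\<bar>(a - real m) / real (Suc m)\<bar> \<le> 1" using Suc.prems by (auto simp: abs_if field_simps)
  ultimately show ?case
    using Suc by (simp only: abs_mult) (metis abs_ge_zero mult_le_one)
qed simp

text \<open>Absorption writes the coefficient as (1 + a) / (m + 1) times (a gchoose m) and so lowers
  a by one, preserving a \<le> m. The descent ends at a \<le> 1, where every factor of the product
  is at most 1 in absolute value.\<close>

lemma abs_gbinomial_le: "0 \<le> a \<Longrightarrow> a \<le> real m \<Longrightarrow> \<bar>(1 + a) gchoose m\<bar> \<le> 1 + a"
proof (induction m arbitrary: a)
  case (Suc m)
  have "real (Suc m) * ((1 + a) gchoose Suc m) = (1 + a) * (a gchoose m)"
    using Suc_times_gbinomial[of m a] by (simp only: add.commute)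
  hence eq: "(1 + a) gchoose Suc m = (1 + a) * ((a gchoose m) / real (Suc m))"
    by (simp add: field_simps del: of_nat_Suc)
  have "\<bar>a gchoose m\<bar> \<le> real (Suc m)"
  proof (cases "a \<le> 1")
    case True
    thus ?thesis using abs_gbinomial_unit[of a m] Suc.prems by simp
  next
    case False
    have "\<bar>(1 + (a - 1)) gchoose m\<bar> \<le> 1 + (a - 1)"
      by (rule Suc.IH) (use False Suc.prems in auto)
    thus ?thesis using Suc.prems by simp
  qed
  hence "\<bar>(a gchoose m) / real (Suc m)\<bar> \<le> 1" by simp
  hence "(1 + a) * \<bar>(a gchoose m) / real (Suc m)\<bar> \<le> (1 + a) * 1"
    using Suc.prems by (intro mult_left_mono) auto
  thus ?case unfolding eq using Suc.prems by (simp add: abs_mult)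
qed simp

subsection \<open>Signs and limits of the function D\<close>

text \<open>Every summand is at most the corresponding one of \<open>E (-a)\<close>, yet the sum grows at least like
  \<open>\<Gamma> (1 + a) / 3 powr a\<close>, which is faster than \<open>\<bar>\<zeta> (-a)\<bar>\<close>.\<close>
definition quarter_sum :: "real \<Rightarrow> real" where
  "quarter_sum a = (\<Sum>n. (1/4) ^ Suc n * real (Suc n) powr a)"

lemma quarter_sum_sums: "(\<lambda>n. (1/4) ^ Suc n * real (Suc n) powr a) sums quarter_sum a"
proof -
  have "summable (\<lambda>n. 1/4 * ((1/4) ^ n * real (Suc n) powr a))"
    by (rule summable_mult, rule summable_power_powr) simp
  thus ?thesis unfolding quarter_sum_def by (intro summable_sums) (simp only: power_Suc mult.assoc)
qed

lemma quarter_sum_ge: "a \<ge> 0 \<Longrightarrow> quarter_sum a \<ge> 1/3"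
proof (rule sums_le[OF _ sums_quarter quarter_sum_sums])
  fix n assume "a \<ge> 0"
  hence "real (Suc n) powr a \<ge> 1" by (intro ge_one_powr_ge_zero) auto
  hence "(1/4) ^ Suc n * 1 \<le> (1/4) ^ Suc n * real (Suc n) powr a"
    by (intro mult_left_mono) auto
  thus "(1/4) ^ Suc n \<le> (1/4) ^ Suc n * real (Suc n) powr a" by simp
qed

lemma powr_add_1_ge:
  assumes "m > 0" "a \<ge> (1::real)"
  shows "m powr a + a * m powr (a - 1) \<le> (m + 1) powr a"
proof -
  have "\<exists>z. m < z \<and> z < m + 1 \<and> (m + 1) powr a - m powr a = (m + 1 - m) * (a * z powr (a - 1))"
    by (rule MVT2) (use assms in \<open>auto intro!: derivative_eq_intros\<close>)
  then obtain z where z: "m < z" "(m + 1) powr a - m powr a = a * z powr (a - 1)" by auto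
  have "m powr (a - 1) \<le> z powr (a - 1)" using assms z by (intro powr_mono2) auto
  hence "a * m powr (a - 1) \<le> a * z powr (a - 1)" using assms by (intro mult_left_mono) auto
  with z(2) show ?thesis by linarith
qed

text \<open>Shifting the index by one costs a weight 1/4, and (m + 1)^a \<ge> m^a + a m^(a - 1). So
  S a is at least a quarter of S a + a * S (a - 1), and the 3 is 4 - 1.\<close>

lemma quarter_sum_step:
  assumes "a \<ge> 1"
  shows "a * quarter_sum (a - 1) \<le> 3 * quarter_sum a"
proof -
  define f where "f = (\<lambda>n. (1/4 :: real) ^ Suc n * real (Suc n) powr a)"
  have f1: "(\<lambda>n. f (Suc n)) sums (quarter_sum a - f 0)"
    by (subst sums_Suc_iff) (use quarter_sum_sums[of a] in \<open>simp add: f_def\<close>)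
  have f2: "(\<lambda>n. 1/4 * f n + 1/4 * a * ((1/4) ^ Suc n * real (Suc n) powr (a - 1)))
      sums (1/4 * quarter_sum a + 1/4 * a * quarter_sum (a - 1))"
    unfolding f_def by (intro sums_add sums_mult quarter_sum_sums)
  have le: "1/4 * f n + 1/4 * a * ((1/4) ^ Suc n * real (Suc n) powr (a - 1)) \<le> f (Suc n)" for n
  proof -
    have "(1/4) ^ Suc (Suc n) * (real (Suc n) powr a + a * real (Suc n) powr (a - 1)) \<le>
        (1/4) ^ Suc (Suc n) * (real (Suc n) + 1) powr a"
      using assms by (intro mult_left_mono powr_add_1_ge) auto
    thus ?thesis by (simp add: f_def algebra_simps)
  qed
  have "1/4 * quarter_sum a + 1/4 * a * quarter_sum (a - 1) \<le> quarter_sum a - f 0"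
    by (rule sums_le[OF le f2 f1])
  moreover have "f 0 = 1/4" by (simp add: f_def)
  ultimately show ?thesis by simp
qed

lemma quarter_sum_step2:
  assumes "a \<ge> 2"
  shows "a * (a - 1) * quarter_sum (a - 2) \<le> 9 * quarter_sum a"
proof -
  have "a * ((a - 1) * quarter_sum (a - 1 - 1)) \<le> a * (3 * quarter_sum (a - 1))"
    using assms by (intro mult_left_mono quarter_sum_step) auto
  also have "\<dots> \<le> 3 * (3 * quarter_sum a)"
    using quarter_sum_step[of a] assms by simp
  finally show ?thesis by (simp add: mult.assoc)
qed

text \<open>With b = a - 2j, raising j multiplies the binomial coefficient by b (b - 1) / ((2j + 2)
  (2j + 3)). The numerator is exactly what \<open>quarter_sum_step2\<close> absorbs, at the price of
  9, when S (b - 2) is replaced by S b.\<close>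

lemma gbinomial_quarter_sum:
  assumes "real (2 * j) \<le> a"
  shows "((1 + a) gchoose (2 * j + 1)) * quarter_sum (a - real (2 * j)) \<ge> 0"
    and "((1 + a) gchoose (2 * j + 1)) * quarter_sum (a - real (2 * j)) \<le>
          (1 + a) * 9 ^ j / fact (2 * j + 1) * quarter_sum a"
  using assms
proof (induction j)
  case 0
  {
    case 1
    thus ?case using quarter_sum_ge[of a] by simp
  next
    case 2
    show ?case by simp
  }
next
  case (Suc j)
  define b where "b = a - real (2 * j)"
  define g where "g = ((1 + a) gchoose (2 * j + 1))"
  define d where "d = real (2 * j + 2) * real (2 * j + 3)"
  have d: "d > 0" by (simp add: d_def)
  have step: "0 \<le> g" "(1 + a gchoose (2 * Suc j + 1)) * quarter_sum (a - real (2 * Suc j)) =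
      g / d * (b * (b - 1) * quarter_sum (b - 2))" "b \<ge> 2" "g * quarter_sum b \<le> (1 + a) * 9 ^ j / fact (2 * j + 1) * quarter_sum a"
    if a: "real (2 * Suc j) \<le> a"
  proof -
    show b: "b \<ge> 2" using a by (simp add: b_def)
    have "g * quarter_sum b \<ge> 0" unfolding g_def b_def using Suc(1) a by simp
    thus "0 \<le> g" using quarter_sum_ge[of b] b by (simp add: zero_le_mult_iff)
    show "g * quarter_sum b \<le> (1 + a) * 9 ^ j / fact (2 * j + 1) * quarter_sum a"
      unfolding g_def b_def using Suc(2) a by simp
    have "((1 + a) gchoose (2 * Suc j + 1)) = g * (b * (b - 1)) / d"
    proof -
      have "((1 + a) gchoose (Suc (Suc (2 * j + 1)))) =
        ((1 + a) gchoose (2 * j + 1)) * ((1 + a - real (2 * j + 1)) * (1 + a - real (2 * j + 2))) / (real (2 * j + 2) * real (2 * j + 3))"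
        by (simp add: gbinomial_prod_rev algebra_simps)
      moreover have "2 * Suc j + 1 = Suc (Suc (2 * j + 1))" by simp
      moreover have "1 + a - real (2 * j + 1) = b" "1 + a - real (2 * j + 2) = b - 1" by (auto simp: b_def)
      ultimately show ?thesis by (simp only: g_def d_def)
    qed
    moreover have "a - real (2 * Suc j) = b - 2" by (simp add: b_def)
    ultimately show "(1 + a gchoose (2 * Suc j + 1)) * quarter_sum (a - real (2 * Suc j)) =
      g / d * (b * (b - 1) * quarter_sum (b - 2))" by (simp only:) simp
  qed
  {
    case 1
    show ?case
      using step[OF 1] d quarter_sum_ge[of "b - 2"]
      by (simp only:) (intro mult_nonneg_nonneg divide_nonneg_nonneg, auto)
  next
    case 2
    have "g / d * (b * (b - 1) * quarter_sum (b - 2)) \<le> g / d * (9 * quarter_sum b)"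
      using step(1,3)[OF 2] d by (intro mult_left_mono quarter_sum_step2) auto
    also have "\<dots> = (g * quarter_sum b) * (9 / d)" by simp
    also have "\<dots> \<le> ((1 + a) * 9 ^ j / fact (2 * j + 1) * quarter_sum a) * (9 / d)"
      using step(4)[OF 2] d by (intro mult_right_mono) auto
    also have "\<dots> = (1 + a) * 9 ^ Suc j / (fact (2 * j + 1) * d) * quarter_sum a"
      by simp
    also have "fact (2 * j + 1) * d = fact (2 * Suc j + 1)"
      by (simp add: d_def algebra_simps)
    finally show ?case using step(2)[OF 2] by simp
  }
qed

lemma zeta_coeff_neg_mult:
  "zeta_coeff j (- a) * (1 + a - real (2 * j)) = ((1 + a) gchoose (2 * j + 1)) / 4 ^ j"
  using zeta_coeff_mult[of j "- a"] by (simp add: algebra_simps)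

text \<open>The argument 2j - a is positive, so L is at most 1 + 2j - a \<le> 2j + 1. This cancels
  the denominator of the coefficient, and \<open>abs_gbinomial_le\<close> leaves only 1 + a.\<close>

lemma zeta1_re_neg_term_far:
  assumes a: "a \<ge> 0" and j: "a < real (2 * j)"
  shows "\<bar>zeta_coeff j (- a) * zeta1_re (- a + real (2 * j))\<bar> \<le> (1 + a) * (1/4) ^ j"
proof -
  have "\<bar>zeta1_re (- a + real (2 * j))\<bar> \<le> real (2 * j + 1)"
    using zeta1_re_bounds[of "- a + real (2 * j)"] a j by auto
  moreover have "\<bar>zeta_coeff j (- a)\<bar> \<le> (1 + a) / (4 ^ j * real (2 * j + 1))"
    using abs_gbinomial_le[OF a, of "2 * j"] j
    by (simp add: zeta_coeff_def abs_mult divide_right_mono del: of_nat_add of_nat_Suc)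
  ultimately have "\<bar>zeta_coeff j (- a) * zeta1_re (- a + real (2 * j))\<bar> \<le>
      (1 + a) / (4 ^ j * real (2 * j + 1)) * real (2 * j + 1)"
    unfolding abs_mult using a by (intro mult_mono) auto
  also have "\<dots> = (1 + a) * (1/4) ^ j"
    by (simp add: power_divide del: of_nat_add of_nat_Suc)
  finally show ?thesis .
qed

text \<open>The factor 1 + (a - 2j) in the assumed bound completes the coefficient to an odd
  binomial coefficient, to which \<open>gbinomial_quarter_sum\<close> applies.\<close>

lemma zeta1_re_neg_term_near:
  assumes "real (2 * Suc j) \<le> a"
    and zeta1_re: "\<bar>zeta1_re (- (a - real (2 * Suc j)))\<bar> \<le> (1 + (a - real (2 * Suc j))) * (9/4 * quarter_sum (a - real (2 * Suc j)))"
  shows "\<bar>zeta_coeff (Suc j) (- a) * zeta1_re (- a + real (2 * Suc j))\<bar> \<le>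
     (1 + a) * (9/4 * quarter_sum a) * (3/8 * (9/80) ^ j)"
proof -
  define c where "c = (1 + a) gchoose (2 * Suc j + 1)"
  define S where "S = quarter_sum (a - real (2 * Suc j))"
  have S: "S \<ge> 1/3" unfolding S_def by (rule quarter_sum_ge) (use assms in simp)
  have c: "c * S \<ge> 0" "c * S \<le> (1 + a) * 9 ^ Suc j / fact (2 * Suc j + 1) * quarter_sum a"
    unfolding c_def S_def using gbinomial_quarter_sum[OF assms(1)] by blast+
  have "\<bar>zeta_coeff (Suc j) (- a) * zeta1_re (- a + real (2 * Suc j))\<bar> =
    \<bar>zeta_coeff (Suc j) (- a)\<bar> * \<bar>zeta1_re (- (a - real (2 * Suc j)))\<bar>"
    by (simp add: abs_mult algebra_simps)
  also have "\<dots> \<le> \<bar>zeta_coeff (Suc j) (- a)\<bar> * ((1 + (a - real (2 * Suc j))) * (9/4 * S))"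
    using zeta1_re unfolding S_def by (intro mult_left_mono) auto
  also have "\<dots> = \<bar>zeta_coeff (Suc j) (- a) * (1 + a - real (2 * Suc j))\<bar> * (9/4 * S)"
  proof -
    have "1 + a - real (2 * Suc j) \<ge> 0" using assms(1) by linarith
    thus ?thesis by (simp add: abs_mult diff_add_eq)
  qed
  also have "\<dots> = 9/4 / 4 ^ Suc j * (c * S)"
    using c(1) S unfolding zeta_coeff_neg_mult c_def [symmetric] by (simp add: abs_mult zero_le_mult_iff)
  also have "\<dots> \<le> 9/4 / 4 ^ Suc j * ((1 + a) * 9 ^ Suc j / fact (2 * Suc j + 1) * quarter_sum a)"
    using c(2) by (intro mult_left_mono) auto
  also have "\<dots> = (1 + a) * (9/4 * quarter_sum a) * ((9/4) ^ Suc j / fact (2 * Suc j + 1))"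
    by (simp add: power_divide mult_ac del: fact_Suc power_Suc)
  also have "\<dots> \<le> (1 + a) * (9/4 * quarter_sum a) * (3/8 * (9/80) ^ j)"
  proof (rule mult_left_mono)
    \<comment> \<open>The value at j = 0 is (9/4) / 3! = 3/8, and each further ratio is at most
      (9/4) / (4 * 5) = 9/80.\<close>
    show "(9/4) ^ Suc j / fact (2 * Suc j + 1) \<le> (3/8 * (9/80) ^ j :: real)"
    proof (induction j)
      case (Suc j)
      have "(9/4 :: real) ^ Suc (Suc j) / fact (2 * Suc (Suc j) + 1) =
         ((9/4) ^ Suc j / fact (2 * Suc j + 1)) * (9/4 / (real (2 * j + 4) * real (2 * j + 5)))"
        by (simp add: fact_numeral field_simps)
      also have "\<dots> \<le> (3/8 * (9/80) ^ j) * (9/4 / 20)"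
      proof (rule mult_mono[OF Suc])
        have "(4::real) * 5 \<le> real (2 * j + 4) * real (2 * j + 5)" by (intro mult_mono) auto
        thus "9/4 / (real (2 * j + 4) * real (2 * j + 5)) \<le> 9/4 / 20" by (intro divide_left_mono) auto
      qed auto
      finally show ?case by simp
    qed (simp add: fact_numeral)
    show "0 \<le> (1 + a) * (9/4 * quarter_sum a)" using assms(1) quarter_sum_ge[of a] by simp
  qed
  finally show ?thesis .
qed

text \<open>The terms with \<open>2 * j \<le> a\<close> are controlled by the induction hypothesis, the remaining ones
  by the elementary bound for \<open>L\<close> on the positive axis.\<close>
lemma zeta1_re_neg_bound:
  "a \<ge> 0 \<Longrightarrow> \<bar>zeta1_re (- a)\<bar> \<le> (1 + a) * (9/4 * quarter_sum a) \<and> \<bar>zeta1_re (- a)\<bar> \<le> (1 + a) * (quarter_sum a + 7/20)"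
proof (induction "nat \<lfloor>a\<rfloor>" arbitrary: a rule: less_induct)
  case (less a)
  note a = \<open>a \<ge> 0\<close>
  define S where "S = quarter_sum a"
  have S: "S \<ge> 1/3" unfolding S_def using a by (rule quarter_sum_ge)
  define f where "f = (\<lambda>j. zeta_coeff j (- a) * zeta1_re (- a + real (2 * j)))"
  have f: "(\<lambda>j. f (Suc j)) sums ((1/2) powr (1 + a) - zeta1_re (- a))"
    by (subst sums_Suc_iff) (use zeta1_re_sums[of "- a"] in \<open>simp add: f_def\<close>)
  have main: "\<bar>zeta1_re (- a)\<bar> \<le> p + (1 + a) * C"
    if g: "g sums C" and p: "(1/2) powr (1 + a) \<le> p" and le: "\<And>j. \<bar>f (Suc j)\<bar> \<le> (1 + a) * g j" for g C p
  proof -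
    have "(1/2) powr (1 + a) - zeta1_re (- a) \<le> (1 + a) * C"
      by (rule sums_le[OF _ f sums_mult[OF g]]) (use le abs_le_D1 in blast)
    moreover have "- ((1/2) powr (1 + a) - zeta1_re (- a)) \<le> (1 + a) * C"
      by (rule sums_le[OF _ sums_minus[OF f] sums_mult[OF g]]) (use le abs_le_D2 in blast)
    moreover have "(1/2) powr (1 + a) \<ge> 0" by simp
    ultimately show ?thesis using p by linarith
  qed
  \<comment> \<open>Slot 0 belongs to the argument 2 - a and is estimated separately in both cases;
    the far bounds from slot 1 on add up to 1/16 + 1/64 + ... = 1/12.\<close>
  have quarter_from_1: "(\<lambda>j. if j = 0 then c else (1/4 :: real) ^ Suc j) sums (c + 1/12)" for c
  proof -
    have "(\<lambda>j. (1/4 :: real) ^ Suc (Suc j)) sums (1/12)"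
      using sums_mult[OF sums_quarter, of "1/4"] by simp
    thus ?thesis
      using sums_Suc_iff[of "\<lambda>j. if j = 0 then c else (1/4 :: real) ^ Suc j" "1/12"] by (simp add: add.commute)
  qed
  have far: "\<bar>f (Suc j)\<bar> \<le> (1 + a) * (1/4) ^ Suc j" if "a < real (2 * Suc j)" for j
    unfolding f_def by (rule zeta1_re_neg_term_far[OF a that])
  \<comment> \<open>The bound 9/4 * S is homogeneous and can be fed back into the induction; S +
    7/20 is the sharper one, needed against E.\<close>
  have min: "y \<le> (1 + a) * u \<and> y \<le> (1 + a) * v" if "y \<le> (1 + a) * min u v" for y u v
    by (intro conjI order_trans[OF that] mult_left_mono) (use a in auto)
  show ?case
  proof (cases "a < 2")
    case True
    \<comment> \<open>The far bound (1 + a) / 4 would be too weak here. Using L(2 - a) \<le> 3 - a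
      gives a (3 - a) / 24, whose maximum 3/32 is attained at a = 3/2.\<close>
    have f1: "\<bar>f (Suc 0)\<bar> \<le> (1 + a) * (3/32)"
    proof -
      have "f (Suc 0) = (1 + a) * (a / 24 * zeta1_re (2 - a))"
        by (simp add: f_def zeta_coeff_Suc algebra_simps)
      moreover have "a / 24 * zeta1_re (2 - a) \<le> 3/32"
      proof -
        have "a / 24 * zeta1_re (2 - a) \<le> a / 24 * (3 - a)"
          using zeta1_re_bounds[of "2 - a"] True a by (intro mult_left_mono) auto
        also have "\<dots> \<le> 3/32" using zero_le_power2[of "2 * a - 3"] by (simp add: power2_eq_square field_simps)
        finally show ?thesis .
      qed
      moreover have "0 \<le> a / 24 * zeta1_re (2 - a)" using zeta1_re_bounds[of "2 - a"] True a by simp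
      moreover have "\<bar>(1 + a) * q\<bar> \<le> (1 + a) * (3/32)" if "q \<le> 3/32" "0 \<le> q" for q
        using a that mult_left_mono[of q "3/32" "1 + a"] by (simp add: abs_mult)
      ultimately show ?thesis by metis
    qed
    have "(1/2 :: real) powr (1 + a) \<le> (1/2) powr 1" using a by (intro powr_mono') auto
    hence "\<bar>zeta1_re (- a)\<bar> \<le> 1/2 + (1 + a) * (3/32 + 1/12)"
      using f1 far True
      by (intro main[OF quarter_from_1]) auto
    also have "\<dots> \<le> (1 + a) * (3/32 + 1/12 + 1/2)" using a by simp
    also have "\<dots> \<le> (1 + a) * min (9/4 * S) (S + 7/20)"
      using S a by (intro mult_left_mono) auto
    finally show ?thesis unfolding S_def by (rule min)
  next
    case False
    hence a2: "a \<ge> 2" by simp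
    have near: "\<bar>f (Suc j)\<bar> \<le> (1 + a) * (9/4 * S) * (3/8 * (9/80) ^ j)" if j: "real (2 * Suc j) \<le> a" for j
      unfolding f_def S_def
    proof (rule zeta1_re_neg_term_near[OF j])
      have "nat \<lfloor>a - real (2 * Suc j)\<rfloor> < nat \<lfloor>a\<rfloor>"
      proof -
        have "\<lfloor>a - real (2 * Suc j)\<rfloor> \<le> \<lfloor>a - 1\<rfloor>" by (rule floor_mono) simp
        moreover have "1 \<le> \<lfloor>a\<rfloor>" using a2 by (simp add: le_floor_iff)
        ultimately show ?thesis by simp
      qed
      from less.hyps[OF this] j show "\<bar>zeta1_re (- (a - real (2 * Suc j)))\<bar> \<le>
          (1 + (a - real (2 * Suc j))) * (9/4 * quarter_sum (a - real (2 * Suc j)))" by simp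
    qed
    define g where "g = (\<lambda>j. 9/4 * S * 3/8 * (9/80) ^ j + (if j = 0 then 0 else (1/4 :: real) ^ Suc j))"
    have "g sums (9/4 * S * 3/8 * (1 / (1 - 9/80)) + (0 + 1/12))"
      unfolding g_def by (intro sums_add quarter_from_1 sums_mult geometric_sums) auto
    moreover have "\<bar>f (Suc j)\<bar> \<le> (1 + a) * g j" for j
    proof (cases "real (2 * Suc j) \<le> a")
      case True
      have "(1 + a) * (9/4 * S) * (3/8 * (9/80) ^ j) \<le> (1 + a) * g j"
        using a by (simp add: g_def mult.assoc mult_left_mono)
      with near[OF True] show ?thesis by linarith
    next
      case False
      hence "j > 0" using a2 by (cases j) auto
      hence "(1 + a) * (1/4) ^ Suc j \<le> (1 + a) * g j"
        using a S by (intro mult_left_mono) (auto simp: g_def)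
      with far[of j] False show ?thesis by linarith
    qed
    moreover have "(1/2 :: real) powr (1 + a) \<le> 1/8"
    proof -
      have "(1/2 :: real) powr (1 + a) \<le> (1/2) powr 3" using a2 by (intro powr_mono') auto
      thus ?thesis by (simp add: powr_numeral power_divide)
    qed
    ultimately have "\<bar>zeta1_re (- a)\<bar> \<le> 1/8 + (1 + a) * (9/4 * S * 3/8 * (1 / (1 - 9/80)) + (0 + 1/12))"
      by (intro main)
    also have "\<dots> \<le> (1 + a) * (9/4 * S * 3/8 * (1 / (1 - 9/80)) + (0 + 1/12) + 1/24)"
      using a2 by (simp add: algebra_simps)
    \<comment> \<open>The coefficient of S is 9/4 * 3/8 * 80/71 = 135/142 < 1 and the constants add
      up to 1/8, so S \<ge> 1/3 gives both bounds.\<close>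
    also have "\<dots> \<le> (1 + a) * min (9/4 * S) (S + 7/20)"
      using S a by (intro mult_left_mono) auto
    finally show ?thesis unfolding S_def by (rule min)
  qed
qed

lemma zeta_excess_ge_partial: "(\<Sum>k<m. 1 / real (k + 2) ^ (2 * Suc n)) \<le> zeta_excess n"
proof -
  have "(\<Sum>k<m. real (k + 2) powr (- real (2 * Suc n))) \<le> zeta_excess n"
    unfolding zeta_excess_def using zeta_excess_sums[of n]
    by (intro sum_le_suminf) (auto simp: sums_iff)
  moreover have "real (k + 2) powr (- real (2 * Suc n)) = 1 / real (k + 2) ^ (2 * Suc n)" for k
    by (subst powr_minus_divide, subst powr_realpow) auto
  ultimately show ?thesis by simp
qed

text \<open>Each coefficient zeta(2n) - 1 is at least its leading part 4^(-n). The surplus at n = 1,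
  where n^a = 1 for every a, already exceeds 3/5 - 1/4 = 7/20.\<close>

lemma E_re_neg_ge:
  assumes a: "a \<ge> 0"
  shows "E_re (- a) > quarter_sum a + 7/20"
proof -
  define h where "h = (\<lambda>n. (zeta_excess n - (1/4) ^ Suc n) * real (Suc n) powr a)"
  have h: "h sums (E_re (- a) - quarter_sum a)"
    unfolding h_def left_diff_distrib using sums_diff[OF E_re_sums[of "- a"] quarter_sum_sums[of a]] by simp
  have "h n \<ge> 0" for n
  proof -
    have "(1/4) ^ Suc n = 1 / (2::real) ^ (2 * Suc n)"
      by (simp add: power_mult power_divide)
    thus ?thesis
      using zeta_excess_ge_partial[where m = 1 and n = n] by (auto simp: h_def intro!: mult_nonneg_nonneg)
  qed
  hence "sum h {0} \<le> suminf h"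
    using h by (intro sum_le_suminf) (auto simp: sums_iff)
  hence "zeta_excess 0 - 1/4 \<le> E_re (- a) - quarter_sum a"
    using h by (simp add: sums_iff h_def)
  moreover have "zeta_excess 0 > 3/5"
    by (rule less_le_trans[OF _ zeta_excess_ge_partial[where m = 25 and n = 0]]) (simp add: sum.lessThan_Suc eval_nat_numeral)
  ultimately show ?thesis by simp
qed

lemma D_pos_nonpos:
  assumes "a \<ge> 0"
  shows "zeta1_re (- a) / (- a - 1) + E_re (- a) > 0"
proof -
  have "\<bar>zeta1_re (- a) / (- a - 1)\<bar> = \<bar>zeta1_re (- a)\<bar> / (1 + a)" using assms by (simp add: abs_divide)
  also have "\<dots> \<le> quarter_sum a + 7/20"
    using zeta1_re_neg_bound[OF assms] assms by (simp add: divide_le_eq mult.commute)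
  finally show ?thesis using E_re_neg_ge[OF assms] by linarith
qed

lemma E_re_nonneg: "E_re x \<ge> 0"
  by (rule sums_le[OF _ sums_zero E_re_sums]) (simp add: zeta_excess_nonneg)

lemma D_pos_gt_1:
  assumes "x > 1"
  shows "zeta1_re x / (x - 1) + E_re x > 0"
proof -
  have "sum (\<lambda>n. real (Suc n) powr (- x)) {0} \<le> zeta1_re x / (x - 1)"
    using zeta1_re_series[OF assms] sum_le_suminf[of "\<lambda>n. real (Suc n) powr (- x)" "{0}"]
    by (auto simp: sums_iff)
  thus ?thesis using E_re_nonneg[of x] by simp
qed

section \<open>Boundedness, continuity and the limit at 1\<close>

lemma E_re_term_le:
  assumes "x \<ge> 0"
  shows "zeta_excess n * real (Suc n) powr (- x) \<le> zeta_excess n"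
proof -
  have "real (Suc n) powr (- x) \<le> real (Suc n) powr 0" using assms by (intro powr_mono) auto
  hence "zeta_excess n * real (Suc n) powr (- x) \<le> zeta_excess n * 1"
    by (intro mult_left_mono zeta_excess_nonneg) simp
  thus ?thesis by simp
qed

lemma zeta_excess_summable: "summable zeta_excess"
  using E_re_sums[of 0] by (simp add: sums_iff)

lemma E_re_le: "x \<ge> 0 \<Longrightarrow> E_re x \<le> suminf zeta_excess"
  using sums_le[OF E_re_term_le E_re_sums summable_sums[OF zeta_excess_summable]] by simp

lemma continuous_on_Er: "continuous_on {0..} E_re"
proof (rule uniform_limit_theorem)
  show "uniform_limit {0..} (\<lambda>m x. \<Sum>n<m. zeta_excess n * real (Suc n) powr (- x)) E_re sequentially"
    unfolding E_re_def [abs_def]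
    by (rule Weierstrass_m_test[OF _ zeta_excess_summable])
       (use E_re_term_le zeta_excess_nonneg in \<open>auto simp del: of_nat_Suc\<close>)
  show "\<forall>\<^sub>F m in sequentially. continuous_on {0..} (\<lambda>x. \<Sum>n<m. zeta_excess n * real (Suc n) powr (- x))"
    by (intro always_eventually allI continuous_intros) auto
qed simp

lemma continuous_on_D: "continuous_on {0..<1} (\<lambda>x. zeta1_re x / (x - 1) + E_re x)"
  by (intro continuous_intros continuous_on_zr continuous_on_subset[OF continuous_on_Er]) auto

lemma D_at_left_1: "filterlim (\<lambda>x. zeta1_re x / (x - 1) + E_re x) at_bot (at_left 1)"
proof -
  have "isCont zeta1_re 1" using continuous_on_zr[of UNIV] by (simp add: continuous_on_eq_continuous_at)
  hence zeta1_re: "(zeta1_re \<longlongrightarrow> 1) (at_left 1)"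
    unfolding isCont_def zeta1_re_1 by (rule tendsto_mono[rotated]) (simp add: at_within_le_at)
  have inv: "filterlim (\<lambda>x::real. inverse (x - 1)) at_bot (at_left 1)"
  proof (rule filterlim_inverse_at_bot)
    show "((\<lambda>x::real. x - 1) \<longlongrightarrow> 0) (at_left 1)" by (auto intro!: tendsto_eq_intros)
    show "\<forall>\<^sub>F x::real in at_left 1. x - 1 < 0" by (simp add: eventually_at_left_field) (auto intro: exI[of _ 0])
  qed
  have "filterlim (\<lambda>x. zeta1_re x * inverse (x - 1)) at_bot (at_left 1)"
    by (rule filterlim_tendsto_pos_mult_at_bot[OF zeta1_re _ inv]) simp
  hence "filterlim (\<lambda>x. suminf zeta_excess + zeta1_re x * inverse (x - 1)) at_bot (at_left 1)"
    by (subst filterlim_tendsto_add_at_bot_iff[OF tendsto_const])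
  moreover have "\<forall>\<^sub>F x in at_left 1. zeta1_re x / (x - 1) + E_re x \<le> suminf zeta_excess + zeta1_re x * inverse (x - 1)"
  proof -
    have "\<forall>\<^sub>F x::real in at_left 1. x > 0" by (rule eventually_at_left_real[of 0 1, THEN eventually_mono]) auto
    thus ?thesis by eventually_elim (use E_re_le in \<open>simp add: divide_inverse less_imp_le\<close>)
  qed
  ultimately show ?thesis by (rule filterlim_at_bot_mono)
qed

subsection \<open>Numerical enclosure of the zero\<close>

text \<open>The tail \<open>n \<ge> 17\<close> starts at the midpoint \<open>33/2\<close>, whose prime factors are among those of
  the first 16 integers; the normalised tail lies between 0 and 1 for \<open>x > 1\<close>.\<close>
definition tail_ratio :: "real \<Rightarrow> real" where
  "tail_ratio x = zeta1_tail 17 x * (33/2) powr (x - 1)"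

lemma zeta1_tail_17: "zeta1_tail 17 x = tail_ratio x * (33/2) powr (1 - x)"
proof -
  have "(33/2) powr (x - 1) * (33/2) powr (1 - x) = (1 :: real)" by (simp flip: powr_add)
  thus ?thesis by (simp add: tail_ratio_def)
qed

text \<open>The normalisation turns the right side into 1, and a shift by 2j costs the factor
  (2/33)^(2j) = (4/1089)^j.\<close>

lemma tail_ratio_sums: "(\<lambda>j. zeta_coeff j x * (4/1089) ^ j * tail_ratio (x + real (2 * j))) sums 1"
proof -
  have "(\<lambda>j. zeta_coeff j x * zeta1_tail 17 (x + of_nat (2 * j)) * (33/2) powr (x - 1)) sums
      ((real 17 - 1/2) powr (1 - x) * (33/2) powr (x - 1))"
    by (intro sums_mult2 zeta1_tail_sums) simp
  moreover have "(real 17 - 1/2) powr (1 - x) * (33/2) powr (x - 1) = 1"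
  proof -
    have "(33/2) powr (1 - x) * (33/2) powr (x - 1) = (1 :: real)" by (simp flip: powr_add)
    thus ?thesis by simp
  qed
  moreover have "zeta_coeff j x * zeta1_tail 17 (x + of_nat (2 * j)) * (33/2) powr (x - 1) =
      zeta_coeff j x * (4/1089) ^ j * tail_ratio (x + real (2 * j))" for j
  proof -
    have "(33/2) powr (x + real (2 * j) - 1) = (33/2) powr (x - 1) * ((33/2 :: real) ^ 2) ^ j"
    proof -
      have "x + real (2 * j) - 1 = (x - 1) + real (2 * j)" by simp
      moreover have "(33/2 :: real) powr real (2 * j) = ((33/2) ^ 2) ^ j"
        by (simp only: power_mult [symmetric]) (rule powr_realpow, simp)
      ultimately show ?thesis by (simp only: powr_add)
    qed
    moreover have "(4/1089 :: real) ^ j * ((33/2) ^ 2) ^ j = 1"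
      by (simp add: power2_eq_square flip: power_mult_distrib)
    ultimately show ?thesis by (simp add: tail_ratio_def mult_ac)
  qed
  ultimately show ?thesis by (simp only:)
qed

lemma tail_ratio_bounds:
  assumes "x > 1"
  shows "0 \<le> tail_ratio x" "tail_ratio x \<le> 1"
proof -
  show "0 \<le> tail_ratio x" unfolding tail_ratio_def using zeta1_tail_nonneg[OF assms] by simp
  have "tail_ratio x * (33/2) powr (1 - x) \<le> 1 * (33/2) powr (1 - x)"
    using zeta1_tail_le[OF assms, of 17] by (simp add: zeta1_tail_17)
  thus "tail_ratio x \<le> 1" by simp
qed

text \<open>For x \<ge> 1 both (x + 2k - 1) / (2k + 2) and (x + 2k) / (2k + 3) are at most x. Crude
  as it is, together with 4/1089 this gives the geometric ratio x^2 / 1089.\<close>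

lemma zeta_coeff_add_le:
  assumes "x \<ge> (1::real)" "m \<ge> 1"
  shows "zeta_coeff (i + m) x \<le> zeta_coeff m x * (x\<^sup>2 / 4) ^ i"
proof (induction i)
  case (Suc i)
  define k where "k = real (i + m)"
  have k: "k \<ge> 1" using assms by (simp add: k_def)
  have "zeta_coeff (Suc i + m) x = zeta_coeff (i + m) x *
      ((x + 2 * k - 1) / (2 * k + 2) * ((x + 2 * k) / (2 * k + 3)) / 4)"
    by (simp add: zeta_coeff_Suc k_def)
  also have "\<dots> \<le> (zeta_coeff m x * (x\<^sup>2 / 4) ^ i) * (x * x / 4)"
  proof (rule mult_mono[OF Suc])
    have kx: "2 * k \<le> 2 * k * x" using assms k by simp
    have e: "x * (2 * k + 2) = 2 * k * x + 2 * x" "x * (2 * k + 3) = 2 * k * x + 3 * x"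
      by (simp_all add: algebra_simps)
    have "(x + 2 * k - 1) / (2 * k + 2) \<le> x"
      by (subst pos_divide_le_eq, use k in simp, unfold e, use kx assms(1) in linarith)
    moreover have "(x + 2 * k) / (2 * k + 3) \<le> x"
      by (subst pos_divide_le_eq, use k in simp, unfold e, use kx assms(1) in linarith)
    ultimately have "(x + 2 * k - 1) / (2 * k + 2) * ((x + 2 * k) / (2 * k + 3)) \<le> x * x"
      using assms k by (intro mult_mono) auto
    thus "(x + 2 * k - 1) / (2 * k + 2) * ((x + 2 * k) / (2 * k + 3)) / 4 \<le> x * x / 4" by simp
  qed (use assms k zeta_coeff_nonneg in auto)
  finally show ?case by (simp add: power2_eq_square mult_ac)
qed simp

lemma tail_ratio_tail_sums:
  "(\<lambda>i. zeta_coeff (i + m) x * (4/1089) ^ (i + m) * tail_ratio (x + real (2 * (i + m)))) sums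
     (1 - (\<Sum>j<m. zeta_coeff j x * (4/1089) ^ j * tail_ratio (x + real (2 * j))))"
  by (subst sums_iff_shift) (use tail_ratio_sums in simp)

text \<open>Every term is nonnegative and every tail ratio at most 1, so the truncation error is
  one-sided and below a geometric series; x < 33 makes its ratio less than 1.\<close>

lemma tail_ratio_tail:
  assumes x: "x > 1" "x < 33" and m: "m \<ge> 1"
  defines "T \<equiv> 1 - (\<Sum>j<m. zeta_coeff j x * (4/1089) ^ j * tail_ratio (x + real (2 * j)))"
  shows "0 \<le> T" "T \<le> zeta_coeff m x * (4/1089) ^ m / (1 - x\<^sup>2 / 1089)"
proof -
  note sums = tail_ratio_tail_sums[of m x, folded T_def]
  have tail_ratio: "0 \<le> tail_ratio (x + real (2 * j))" "tail_ratio (x + real (2 * j)) \<le> 1" for j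
    using tail_ratio_bounds[of "x + real (2 * j)"] x by auto
  have zc: "zeta_coeff j x \<ge> 0" for j using x by (intro zeta_coeff_nonneg) simp
  show "0 \<le> T"
    by (rule sums_le[OF _ sums_zero sums]) (intro mult_nonneg_nonneg zc tail_ratio, simp)
  have x2: "x\<^sup>2 / 1089 < 1" using power_strict_mono[of x 33 2] x by simp
  have "T \<le> zeta_coeff m x * (4/1089) ^ m * (1 / (1 - x\<^sup>2 / 1089))"
  proof (rule sums_le[OF _ sums sums_mult[OF geometric_sums]])
    fix i
    have "zeta_coeff (i + m) x * (4/1089) ^ (i + m) * tail_ratio (x + real (2 * (i + m))) \<le>
        (zeta_coeff m x * (x\<^sup>2 / 4) ^ i) * (4/1089) ^ (i + m) * 1"
      using x m zc by (intro mult_mono zeta_coeff_add_le tail_ratio mult_nonneg_nonneg) auto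
    also have "\<dots> = zeta_coeff m x * (4/1089) ^ m * (x\<^sup>2 / 1089) ^ i"
    proof -
      have "(x\<^sup>2 / 4) ^ i * (4/1089 :: real) ^ i = (x\<^sup>2 / 1089) ^ i"
        by (simp flip: power_mult_distrib)
      thus ?thesis by (simp add: power_add mult_ac)
    qed
    finally show "zeta_coeff (i + m) x * (4/1089) ^ (i + m) * tail_ratio (x + real (2 * (i + m))) \<le>
      zeta_coeff m x * (4/1089) ^ m * (x\<^sup>2 / 1089) ^ i" .
  qed (use x2 in simp)
  thus "T \<le> zeta_coeff m x * (4/1089) ^ m / (1 - x\<^sup>2 / 1089)" by simp
qed

text \<open>The denominators are 4^j (2j + 1)!, that is 4 * 6, 16 * 120 and 64 * 5040.\<close>

lemma zeta_coeff_1: "zeta_coeff (Suc 0) x = (x - 1) * x / 24"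
  and zeta_coeff_2: "zeta_coeff (Suc (Suc 0)) x = (x - 1) * x * (x + 1) * (x + 2) / 1920"
  and zeta_coeff_3: "zeta_coeff (Suc (Suc (Suc 0))) x =
    (x - 1) * x * (x + 1) * (x + 2) * (x + 3) * (x + 4) / 322560"
  for x :: real
  by (simp_all add: zeta_coeff_Suc add_ac)

lemma tail_ratio_expand_1:
  assumes "x > 1" "x < 33"
  shows "1 - (x - 1) * x / 24 * (4/1089) / (1 - x\<^sup>2 / 1089) \<le> tail_ratio x"
  using tail_ratio_tail(2)[OF assms, of 1] by (simp add: zeta_coeff_1)

lemma tail_ratio_expand_2:
  assumes "x > 1" "x < 33"
  defines "T \<equiv> 1 - tail_ratio x - (x - 1) * x / 24 * (4/1089) * tail_ratio (x + 2)"
  shows "0 \<le> T" "T \<le> (x - 1) * x * (x + 1) * (x + 2) / 1920 * (4/1089)\<^sup>2 / (1 - x\<^sup>2 / 1089)"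
proof -
  have "(\<Sum>j<2. zeta_coeff j x * (4/1089) ^ j * tail_ratio (x + real (2 * j))) =
      tail_ratio x + (x - 1) * x / 24 * (4/1089) * tail_ratio (x + 2)"
    by (simp add: numeral_2_eq_2 zeta_coeff_1)
  with tail_ratio_tail[OF assms(1,2), of 2]
  show "0 \<le> T" "T \<le> (x - 1) * x * (x + 1) * (x + 2) / 1920 * (4/1089)\<^sup>2 / (1 - x\<^sup>2 / 1089)"
    unfolding T_def by (simp_all only: diff_diff_eq) (simp_all add: numeral_2_eq_2 zeta_coeff_2)
qed

lemma tail_ratio_sum_3:
  "(\<Sum>j<3. zeta_coeff j x * (4/1089) ^ j * tail_ratio (x + real (2 * j))) =
      tail_ratio x + (x - 1) * x / 24 * (4/1089) * tail_ratio (x + 2)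
       + (x - 1) * x * (x + 1) * (x + 2) / 1920 * (4/1089)\<^sup>2 * tail_ratio (x + 4)"
  by (simp add: numeral_3_eq_3 zeta_coeff_1 zeta_coeff_2 power2_eq_square)

lemma tail_ratio_expand_3:
  assumes "x > 1" "x < 33"
  defines "T \<equiv> 1 - tail_ratio x - (x - 1) * x / 24 * (4/1089) * tail_ratio (x + 2)
       - (x - 1) * x * (x + 1) * (x + 2) / 1920 * (4/1089)\<^sup>2 * tail_ratio (x + 4)"
  shows "0 \<le> T" "T \<le> (x - 1) * x * (x + 1) * (x + 2) * (x + 3) * (x + 4) / 322560 * (4/1089) ^ 3 / (1 - x\<^sup>2 / 1089)"
  using tail_ratio_tail[OF assms(1,2), of 3] unfolding T_def tail_ratio_sum_3
  by (simp_all only: diff_diff_eq) (simp_all add: numeral_3_eq_3 zeta_coeff_3)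

text \<open>On [0, 1] the coefficients are nonpositive, so the truncation error has the opposite
  sign. Here 2688 = 6 * 7 * 4^3 comes from the coefficient bound at j = 3, and 1089/1088 sums the
  powers of 1/1089.\<close>

lemma tail_ratio_expand_unit:
  assumes x: "0 \<le> x" "x \<le> 1"
  defines "T \<equiv> 1 - tail_ratio x - (x - 1) * x / 24 * (4/1089) * tail_ratio (x + 2)
       - (x - 1) * x * (x + 1) * (x + 2) / 1920 * (4/1089)\<^sup>2 * tail_ratio (x + 4)"
  shows "- (x * (1 - x) / 2688 * (4/1089) ^ 3 * (1089/1088)) \<le> T" "T \<le> 0"
proof -
  have T: "T = 1 - tail_ratio x - (x - 1) * x / 24 * (4/1089) * tail_ratio (x + 2)
       - (x - 1) * x * (x + 1) * (x + 2) / 1920 * (4/1089)\<^sup>2 * tail_ratio (x + 4)"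
    by (simp add: T_def)
  have sums: "(\<lambda>i. zeta_coeff (i + 3) x * (4/1089) ^ (i + 3) * tail_ratio (x + real (2 * (i + 3)))) sums T"
    using tail_ratio_tail_sums[of 3 x] unfolding tail_ratio_sum_3 T by (simp only: diff_diff_eq)
  have tail_ratio: "0 \<le> tail_ratio (x + real (2 * (i + 3)))" "tail_ratio (x + real (2 * (i + 3))) \<le> 1" for i
    using tail_ratio_bounds[of "x + real (2 * (i + 3))"] x by auto
  have zc: "zeta_coeff (i + 3) x \<le> 0" "- zeta_coeff (i + 3) x \<le> x * (1 - x) / 2688 * (1/4) ^ i" for i
  proof -
    show "zeta_coeff (i + 3) x \<le> 0"
      using zeta_coeff_unit_bounds(1)[OF x, of "i + 2"] by (simp add: numeral_3_eq_3)
    have "- zeta_coeff (Suc (i + 2)) x \<le> x * (1 - x) / (real (2 * (i + 2) + 2) * real (2 * (i + 2) + 3) * 4 ^ Suc (i + 2))"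
      by (rule zeta_coeff_unit_bounds(2)[OF x])
    also have "\<dots> \<le> x * (1 - x) / (6 * 7 * 4 ^ Suc (i + 2))"
      using x by (intro divide_left_mono mult_mono) auto
    also have "\<dots> = x * (1 - x) / 2688 * (1/4) ^ i" by (simp add: power_divide power_add)
    finally show "- zeta_coeff (i + 3) x \<le> x * (1 - x) / 2688 * (1/4) ^ i"
      by (simp add: numeral_3_eq_3)
  qed
  show "T \<le> 0"
    by (rule sums_le[OF _ sums sums_zero]) (intro mult_nonpos_nonneg zc tail_ratio, simp)
  have "- T \<le> x * (1 - x) / 2688 * (4/1089) ^ 3 * (1 / (1 - 1/1089))"
  proof (rule sums_le[OF _ sums_minus[OF sums] sums_mult[OF geometric_sums]])
    fix i
    have "- (zeta_coeff (i + 3) x * (4/1089) ^ (i + 3) * tail_ratio (x + real (2 * (i + 3)))) =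
       (- zeta_coeff (i + 3) x) * (4/1089) ^ (i + 3) * tail_ratio (x + real (2 * (i + 3)))" by simp
    also have "\<dots> \<le> (x * (1 - x) / 2688 * (1/4) ^ i) * (4/1089) ^ (i + 3) * 1"
      using x zc tail_ratio by (intro mult_mono mult_nonneg_nonneg) auto
    also have "\<dots> = x * (1 - x) / 2688 * (4/1089) ^ 3 * (1/1089) ^ i"
    proof -
      have "(1/4) ^ i * (4/1089 :: real) ^ i = (1/1089) ^ i"
        by (simp flip: power_mult_distrib)
      thus ?thesis by (simp add: power_add)
    qed
    finally show "- (zeta_coeff (i + 3) x * (4/1089) ^ (i + 3) * tail_ratio (x + real (2 * (i + 3))))
       \<le> x * (1 - x) / 2688 * (4/1089) ^ 3 * (1/1089) ^ i" .
  qed simp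
  thus "- (x * (1 - x) / 2688 * (4/1089) ^ 3 * (1089/1088)) \<le> T" by simp
qed

lemma zeta_excess_split:
  "zeta_excess n = (\<Sum>k<m. 1 / real (k + 2) ^ (2 * Suc n)) + zeta1_tail (m + 2) (real (2 * Suc n)) / real (2 * n + 1)"
proof -
  define x where "x = real (2 * Suc n)"
  have x1: "x - 1 = real (2 * n + 1)" by (simp add: x_def)
  have p: "real (k + 2) powr (- x) = 1 / real (k + 2) ^ (2 * Suc n)" for k
    unfolding x_def by (subst powr_minus_divide, subst powr_realpow) auto
  have "(\<Sum>k=1..<m + 2. real k powr (- x)) = 1 + (\<Sum>k<m. real (k + 2) powr (- x))"
  proof -
    have "(\<Sum>k=1..<m + 2. real k powr (- x)) = (\<Sum>k<m + 1. real (k + 1) powr (- x))"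
      by (rule sum.reindex_bij_witness[of _ "\<lambda>k. k + 1" "\<lambda>k. k - 1"]) auto
    also have "\<dots> = 1 + (\<Sum>k<m. real (k + 2) powr (- x))"
      by (simp only: Suc_eq_plus1 [symmetric] sum.lessThan_Suc_shift) (simp add: add_ac)
    finally show ?thesis .
  qed
  hence "zeta1_tail (m + 2) x = zeta1_re x - (x - 1) * (1 + (\<Sum>k<m. 1 / real (k + 2) ^ (2 * Suc n)))"
    unfolding zeta1_tail_def p by (simp only:)
  moreover have "zeta1_re x = (x - 1) * (zeta_excess n + 1)"
    using zeta_excess_eq[OF x_def] x1 by (simp add: field_simps)
  ultimately have "zeta1_tail (m + 2) x / (x - 1) = zeta_excess n - (\<Sum>k<m. 1 / real (k + 2) ^ (2 * Suc n))"
    using x1 by (simp add: field_simps)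
  thus ?thesis unfolding x1 x_def by simp
qed

lemma zeta_excess_rr:
  "zeta_excess n = (\<Sum>k<15. 1 / real (k + 2) ^ (2 * Suc n)) + tail_ratio (real (2 * Suc n)) * (2/33) ^ (2 * n + 1) / real (2 * n + 1)"
proof -
  have eq: "(33/2 :: real) powr (1 - real (2 * Suc n)) = (2/33) ^ (2 * n + 1)"
  proof -
    have "1 - real (2 * Suc n) = - real (2 * n + 1)" by simp
    hence "(33/2 :: real) powr (1 - real (2 * Suc n)) = 1 / (33/2) ^ (2 * n + 1)"
      by (simp only: powr_minus_divide) (subst powr_realpow, auto)
    thus ?thesis by (simp add: power_divide)
  qed
  have "15 + 2 = (17 :: nat)" by simp
  from zeta_excess_split[of n 15, unfolded this zeta1_tail_17 eq] show ?thesis .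
qed

text \<open>Meant for larger n, where the whole tail is below the required accuracy and a few
  explicit terms suffice.\<close>

lemma zeta_excess_upper:
  "zeta_excess n \<le> (\<Sum>k<m. 1 / real (k + 2) ^ (2 * Suc n)) + (2 / real (2 * m + 3)) ^ (2 * n + 1) / real (2 * n + 1)"
proof -
  have "zeta1_tail (m + 2) (real (2 * Suc n)) \<le> (real (m + 2) - 1/2) powr (1 - real (2 * Suc n))"
    by (rule zeta1_tail_le) auto
  also have "\<dots> = (2 / real (2 * m + 3)) ^ (2 * n + 1)"
  proof -
    have "1 - real (2 * Suc n) = - real (2 * n + 1)" "real (m + 2) - 1/2 = real (2 * m + 3) / 2" by auto
    hence "(real (m + 2) - 1/2) powr (1 - real (2 * Suc n)) = 1 / (real (2 * m + 3) / 2) ^ (2 * n + 1)"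
      by (simp only: powr_minus_divide) (subst powr_realpow, auto)
    thus ?thesis by (simp add: power_divide)
  qed
  finally have z: "zeta1_tail (m + 2) (real (2 * Suc n)) \<le> (2 / real (2 * m + 3)) ^ (2 * n + 1)" .
  show ?thesis unfolding zeta_excess_split[of n m] by (intro add_left_mono divide_right_mono z) simp
qed

section \<open>Rational enclosures of powers\<close>

lemma exp_minus_lower:
  "1 - t * (1 - t/2 * (1 - t/3 * (1 - t/4 * (1 - t/5 * (1 - t/6 * (1 - t/7)))))) \<le> exp (- t :: real)"
proof -
  obtain u where u: "exp (- t) = (\<Sum>m<8. (- t) ^ m / fact m) + exp u / fact 8 * (- t) ^ 8"
    using Maclaurin_exp_le[of "- t" 8] by blast
  have "(\<Sum>m<8. (- t) ^ m / fact m) =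
      1 - t * (1 - t/2 * (1 - t/3 * (1 - t/4 * (1 - t/5 * (1 - t/6 * (1 - t/7))))))"
    by (simp add: eval_nat_numeral fact_numeral) (simp add: field_simps)
  moreover have "exp u / fact 8 * (- t) ^ 8 \<ge> 0" by simp
  ultimately show ?thesis using u by linarith
qed

text \<open>Horner form of a Taylor polynomial. Degree 8 leaves a Lagrange remainder with (-t)^9
  \<le> 0, whereas degree 7 in the lower bound leaves one with (-t)^8 \<ge> 0.\<close>

lemma exp_minus_upper:
  assumes "t \<ge> 0"
  shows "exp (- t :: real) \<le>
    1 - t * (1 - t/2 * (1 - t/3 * (1 - t/4 * (1 - t/5 * (1 - t/6 * (1 - t/7 * (1 - t/8)))))))"
proof -
  obtain u where u: "exp (- t) = (\<Sum>m<9. (- t) ^ m / fact m) + exp u / fact 9 * (- t) ^ 9"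
    using Maclaurin_exp_le[of "- t" 9] by blast
  have "(\<Sum>m<9. (- t) ^ m / fact m) =
      1 - t * (1 - t/2 * (1 - t/3 * (1 - t/4 * (1 - t/5 * (1 - t/6 * (1 - t/7 * (1 - t/8)))))))"
    by (simp add: eval_nat_numeral fact_numeral) (simp add: field_simps)
  moreover have "exp u / fact 9 * (- t) ^ 9 \<le> 0"
    using assms by (intro mult_nonneg_nonpos) (auto simp: power_minus_odd)
  ultimately show ?thesis using u by linarith
qed

text \<open>The rationals t and t' enclose s * ln x, so the hypotheses besides the logarithm bound
  become pure rational arithmetic.\<close>

lemma powr_minus_bounds:
  fixes x s :: real
  assumes "ln x \<in> {a..b}" "0 < x" "0 \<le> s" "0 \<le> t" "t \<le> s * a" "s * b \<le> t'"
    and "l \<le> 1 - t' * (1 - t'/2 * (1 - t'/3 * (1 - t'/4 * (1 - t'/5 * (1 - t'/6 * (1 - t'/7))))))"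
    and "1 - t * (1 - t/2 * (1 - t/3 * (1 - t/4 * (1 - t/5 * (1 - t/6 * (1 - t/7 * (1 - t/8))))))) \<le> u"
  shows "x powr (- s) \<in> {l..u}"
proof -
  have "s * a \<le> s * ln x" "s * ln x \<le> s * b"
    using assms(1,3) by (auto intro: mult_left_mono)
  hence "exp (- t') \<le> x powr (- s)" "x powr (- s) \<le> exp (- t)"
    using assms(2,5,6) by (auto simp: powr_def)
  thus ?thesis
    using exp_minus_lower[of t'] exp_minus_upper[OF assms(4)] assms(7,8) by auto
qed

lemma powr_mult_bounds:
  fixes x y p :: real
  assumes "x powr p \<in> {a..b}" "y powr p \<in> {c..d}" "l \<le> a * c" "b * d \<le> u"
    and "0 \<le> x" "0 \<le> y" "0 \<le> a" "0 \<le> c"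
  shows "(x * y) powr p \<in> {l..u}"
proof -
  have "a * c \<le> x powr p * y powr p" "x powr p * y powr p \<le> b * d"
    using assms by (auto intro!: mult_mono)
  thus ?thesis using assms by (auto simp: powr_mult)
qed

text \<open>The terms n \<le> 16 of zeta and E are merged, so each power is used once. The tail of
  zeta enters negatively because L is divided by s - 1 < 0.\<close>

lemma D_decomposition:
  "zeta1_re s / (s - 1) + E_re s = (\<Sum>n<16. (1 + zeta_excess n) * real (Suc n) powr (- s))
     + (E_re s - (\<Sum>n<16. zeta_excess n * real (Suc n) powr (- s))) - tail_ratio s * (33/2) * (33/2) powr (- s) / (1 - s)"
  if "s < 1"
proof -
  have "zeta1_re s = zeta1_tail 17 s + (s - 1) * (\<Sum>n=1..<17. real n powr (- s))" by (simp add: zeta1_tail_def)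
  moreover have "(\<Sum>n=1..<17. real n powr (- s)) = (\<Sum>n<16. real (Suc n) powr (- s))"
    by (rule sum.reindex_bij_witness[of _ Suc "\<lambda>k. k - 1"]) auto
  ultimately have "zeta1_re s / (s - 1) = (\<Sum>n<16. real (Suc n) powr (- s)) + zeta1_tail 17 s / (s - 1)"
    using that by (simp add: add_divide_distrib)
  moreover have "zeta1_tail 17 s / (s - 1) = - (tail_ratio s * (33/2) * (33/2) powr (- s) / (1 - s))"
  proof -
    have eq: "(33/2 :: real) powr (1 - s) = (33/2) * (33/2) powr (- s)"
      using powr_add[of "33/2 :: real" 1 "- s"] by simp
    have "A / (s - 1) = - (A / (1 - s))" for A
      using that by (simp add: field_simps)
    thus ?thesis unfolding zeta1_tail_17 eq mult.assoc by blast
  qed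
  ultimately show ?thesis
    by (simp add: sum.distrib distrib_right)
qed

text \<open>From index 15 on the coefficients drop by a factor 4 each time, and 1/4 + 1/16 + ... =
  1/3. At the points used this rest is below 10^(-10).\<close>

lemma E_re_tail:
  assumes "s \<ge> 0"
  shows "0 \<le> E_re s - (\<Sum>n<16. zeta_excess n * real (Suc n) powr (- s))"
    and "E_re s - (\<Sum>n<16. zeta_excess n * real (Suc n) powr (- s)) \<le> zeta_excess 15 / 3"
proof -
  have sums: "(\<lambda>n. zeta_excess (n + 16) * real (Suc (n + 16)) powr (- s)) sums
      (E_re s - (\<Sum>n<16. zeta_excess n * real (Suc n) powr (- s)))"
    by (subst sums_iff_shift[of "\<lambda>n. zeta_excess n * real (Suc n) powr (- s)"]) (use E_re_sums[of s] in simp)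
  show "0 \<le> E_re s - (\<Sum>n<16. zeta_excess n * real (Suc n) powr (- s))"
    by (rule sums_le[OF _ sums_zero sums]) (simp add: zeta_excess_nonneg)
  have "E_re s - (\<Sum>n<16. zeta_excess n * real (Suc n) powr (- s)) \<le> zeta_excess 15 * (1/3)"
  proof (rule sums_le[OF _ sums sums_mult[OF sums_quarter]])
    fix n
    have "zeta_excess (n + 16) * real (Suc (n + 16)) powr (- s) \<le> zeta_excess (n + 16)"
      by (rule E_re_term_le) fact
    also have "\<dots> \<le> zeta_excess 15 * (1/4) ^ Suc n"
      using zeta_excess_shift_le[of 15 "Suc n"] by (simp add: power_divide add.commute)
    finally show "zeta_excess (n + 16) * real (Suc (n + 16)) powr - s \<le> zeta_excess 15 * (1/4) ^ Suc n" .
  qed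
  thus "E_re s - (\<Sum>n<16. zeta_excess n * real (Suc n) powr (- s)) \<le> zeta_excess 15 / 3" by simp
qed

text \<open>Ratios near 1 make the logarithm series converge fast. They generate all primes up to
  13: 2 = 4/3 * 3/2, 3 = 2 * 3/2, 5 = 4 * 5/4, 7 = 6 * 7/6, 11 = 10 * 11/10, 13 = 12 *
  13/12.\<close>

lemma ln_ratio_bounds:
  shows ln_4_3: "ln (4/3 :: real) \<in> {0.287682072451780..0.287682072451781}"
    and ln_3_2: "ln (3/2 :: real) \<in> {0.405465108108164..0.405465108108165}"
    and ln_5_4: "ln (5/4 :: real) \<in> {0.223143551314209..0.223143551314210}"
    and ln_7_6: "ln (7/6 :: real) \<in> {0.154150679827258..0.154150679827259}"
    and ln_11_10: "ln (11/10 :: real) \<in> {0.095310179804324..0.095310179804325}"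
    and ln_13_12: "ln (13/12 :: real) \<in> {0.080042707673536..0.080042707673537}"
proof -
  show "ln (4/3 :: real) \<in> {0.287682072451780..0.287682072451781}"
    using ln_approx_bounds[of "4/3" 9] by (simp add: eval_nat_numeral)
  show "ln (3/2 :: real) \<in> {0.405465108108164..0.405465108108165}"
    using ln_approx_bounds[of "3/2" 12] by (simp add: eval_nat_numeral)
  show "ln (5/4 :: real) \<in> {0.223143551314209..0.223143551314210}"
    using ln_approx_bounds[of "5/4" 9] by (simp add: eval_nat_numeral)
  show "ln (7/6 :: real) \<in> {0.154150679827258..0.154150679827259}"
    using ln_approx_bounds[of "7/6" 8] by (simp add: eval_nat_numeral)
  show "ln (11/10 :: real) \<in> {0.095310179804324..0.095310179804325}"
    using ln_approx_bounds[of "11/10" 7] by (simp add: eval_nat_numeral)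
  show "ln (13/12 :: real) \<in> {0.080042707673536..0.080042707673537}"
    using ln_approx_bounds[of "13/12" 6] by (simp add: eval_nat_numeral)
qed

text \<open>Lower estimates of (i + 1)^(-s) at the left end s = 0.200411339, where D is to be shown
  positive.\<close>

definition pow_lower :: "real list" where
  "pow_lower =
   [1, 0.8703023886341, 0.8023788831320, 0.7574262476622, 0.7243000005155,
    0.6983122585793, 0.6770687511637, 0.6591898725545, 0.6438118720961, 0.6303600205363,
    0.6184336290761, 0.6077428266540, 0.5980715189971, 0.5892545514072, 0.5811630254661,
    0.5736945206475]"

lemma pow_lower_bounds:
  fixes s :: real
  assumes s: "s = 200411339/1000000000"
  shows "i < 16 \<Longrightarrow> pow_lower ! i \<le> real (Suc i) powr (- s)"
    and "(33/2) powr (- s) \<le> 0.5701674395834"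
proof -
  \<comment> \<open>Throughout, \<open>t\<close> and \<open>t'\<close> are s times the ends of the
    logarithm enclosure, rounded outwards.\<close>
  have q4: "(4/3) powr (- s) \<in> {0.9439757994449..0.9439757994451}"
    by (rule powr_minus_bounds[OF ln_4_3, where t = "0.0576547493463" and t' = "0.0576547493464"]) (simp_all add: s)
  have q3: "(3/2) powr (- s) \<in> {0.9219541318177..0.9219541318179}"
    by (rule powr_minus_bounds[OF ln_3_2, where t = "0.0812598052337" and t' = "0.0812598052338"]) (simp_all add: s)
  have q5: "(5/4) powr (- s) \<in> {0.9562647224745..0.9562647224747}"
    by (rule powr_minus_bounds[OF ln_5_4, where t = "0.0447204979080" and t' = "0.0447204979081"]) (simp_all add: s)
  have q7: "(7/6) powr (- s) \<in> {0.9695787849139..0.9695787849141}"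
    by (rule powr_minus_bounds[OF ln_7_6, where t = "0.0308935441519" and t' = "0.0308935441520"]) (simp_all add: s)
  have q11: "(11/10) powr (- s) \<in> {0.9810800319316..0.9810800319318}"
    by (rule powr_minus_bounds[OF ln_11_10, where t = "0.0191012407549" and t' = "0.0191012407550"]) (simp_all add: s)
  have q13: "(13/12) powr (- s) \<in> {0.9840865128593..0.9840865128595}"
    by (rule powr_minus_bounds[OF ln_13_12, where t = "0.0160414662220" and t' = "0.0160414662221"]) (simp_all add: s)
  have p2: "2 powr (- s) \<in> {0.8703023886341..0.8703023886346}"
    using powr_mult_bounds[OF q4 q3, of "0.8703023886341" "0.8703023886346"] by simp
  have p3: "3 powr (- s) \<in> {0.8023788831320..0.8023788831327}"
    using powr_mult_bounds[OF p2 q3, of "0.8023788831320" "0.8023788831327"] by simp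
  have p4: "4 powr (- s) \<in> {0.7574262476622..0.7574262476631}"
    using powr_mult_bounds[OF p2 p2, of "0.7574262476622" "0.7574262476631"] by simp
  have p5: "5 powr (- s) \<in> {0.7243000005155..0.7243000005167}"
    using powr_mult_bounds[OF p4 q5, of "0.7243000005155" "0.7243000005167"] by simp
  have p6: "6 powr (- s) \<in> {0.6983122585793..0.6983122585804}"
    using powr_mult_bounds[OF p2 p3, of "0.6983122585793" "0.6983122585804"] by simp
  have p7: "7 powr (- s) \<in> {0.6770687511637..0.6770687511651}"
    using powr_mult_bounds[OF p6 q7, of "0.6770687511637" "0.6770687511651"] by simp
  have p8: "8 powr (- s) \<in> {0.6591898725545..0.6591898725558}"
    using powr_mult_bounds[OF p2 p4, of "0.6591898725545" "0.6591898725558"] by simp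
  have p9: "9 powr (- s) \<in> {0.6438118720961..0.6438118720973}"
    using powr_mult_bounds[OF p3 p3, of "0.6438118720961" "0.6438118720973"] by simp
  have p10: "10 powr (- s) \<in> {0.6303600205363..0.6303600205378}"
    using powr_mult_bounds[OF p2 p5, of "0.6303600205363" "0.6303600205378"] by simp
  have p11: "11 powr (- s) \<in> {0.6184336290761..0.6184336290778}"
    using powr_mult_bounds[OF p10 q11, of "0.6184336290761" "0.6184336290778"] by simp
  have p12: "12 powr (- s) \<in> {0.6077428266540..0.6077428266554}"
    using powr_mult_bounds[OF p2 p6, of "0.6077428266540" "0.6077428266554"] by simp
  have p13: "13 powr (- s) \<in> {0.5980715189971..0.5980715189987}"
    using powr_mult_bounds[OF p12 q13, of "0.5980715189971" "0.5980715189987"] by simp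
  have p14: "14 powr (- s) \<in> {0.5892545514072..0.5892545514089}"
    using powr_mult_bounds[OF p2 p7, of "0.5892545514072" "0.5892545514089"] by simp
  have p15: "15 powr (- s) \<in> {0.5811630254661..0.5811630254677}"
    using powr_mult_bounds[OF p3 p5, of "0.5811630254661" "0.5811630254677"] by simp
  have p16: "16 powr (- s) \<in> {0.5736945206475..0.5736945206491}"
    using powr_mult_bounds[OF p2 p8, of "0.5736945206475" "0.5736945206491"] by simp
  \<comment> \<open>Since 11/2 = 11/10 * 5 and 33/2 = 3 * 11/2, the midpoint requires no further
    logarithm.\<close>
  have h11: "(11/2) powr (- s) \<in> {0.7105962676338..0.7105962676352}"
    using powr_mult_bounds[OF q11 p5, of "0.7105962676338" "0.7105962676352"] by simp
  have h33: "(33/2) powr (- s) \<in> {0.5701674395817..0.5701674395834}"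
    using powr_mult_bounds[OF p3 h11, of "0.5701674395817" "0.5701674395834"] by simp
  have "list_all2 (\<le>) pow_lower (map (\<lambda>i. real (Suc i) powr (- s)) [0..<16])"
    using p2 p3 p4 p5 p6 p7 p8 p9 p10 p11 p12 p13 p14 p15 p16
    by (simp add: pow_lower_def upt_rec)
  from list_all2_nthD2[OF this, of i] show "i < 16 \<Longrightarrow> pow_lower ! i \<le> real (Suc i) powr (- s)" by simp
  show "(33/2) powr (- s) \<le> 0.5701674395834" using h33 by simp
qed

text \<open>Upper estimates of (i + 1)^(-s) at the right end s = 0.20041134, where D is to be shown
  negative.\<close>

definition pow_upper :: "real list" where
  "pow_upper =
   [1, 0.8703023880314, 0.8023788822513, 0.7574262466132, 0.7242999993510,
    0.6983122573293, 0.6770687498477, 0.6591898711852, 0.6438118706829, 0.6303600190864,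
    0.6184336275949, 0.6077428251453, 0.5980715174648, 0.5892545498539, 0.5811630238939,
    0.5736945190586]"

lemma pow_upper_bounds:
  fixes s :: real
  assumes s: "s = 10020567/50000000"
  shows "i < 16 \<Longrightarrow> real (Suc i) powr (- s) \<le> pow_upper ! i"
    and "0.5701674379832 \<le> (33/2) powr (- s)"
proof -
  have q4: "(4/3) powr (- s) \<in> {0.9439757991734..0.9439757991736}"
    by (rule powr_minus_bounds[OF ln_4_3, where t = "0.0576547496340" and t' = "0.0576547496341"]) (simp_all add: s)
  have q3: "(3/2) powr (- s) \<in> {0.9219541314438..0.9219541314441}"
    by (rule powr_minus_bounds[OF ln_3_2, where t = "0.0812598056392" and t' = "0.0812598056393"]) (simp_all add: s)
  have q5: "(5/4) powr (- s) \<in> {0.9562647222611..0.9562647222613}"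
    by (rule powr_minus_bounds[OF ln_5_4, where t = "0.0447204981312" and t' = "0.0447204981313"]) (simp_all add: s)
  have q7: "(7/6) powr (- s) \<in> {0.9695787847645..0.9695787847647}"
    by (rule powr_minus_bounds[OF ln_7_6, where t = "0.0308935443060" and t' = "0.0308935443061"]) (simp_all add: s)
  have q11: "(11/10) powr (- s) \<in> {0.9810800318381..0.9810800318383}"
    by (rule powr_minus_bounds[OF ln_11_10, where t = "0.0191012408502" and t' = "0.0191012408503"]) (simp_all add: s)
  have q13: "(13/12) powr (- s) \<in> {0.9840865127805..0.9840865127807}"
    by (rule powr_minus_bounds[OF ln_13_12, where t = "0.0160414663020" and t' = "0.0160414663021"]) (simp_all add: s)
  have p2: "2 powr (- s) \<in> {0.8703023880308..0.8703023880314}"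
    using powr_mult_bounds[OF q4 q3, of "0.8703023880308" "0.8703023880314"] by simp
  have p3: "3 powr (- s) \<in> {0.8023788822504..0.8023788822513}"
    using powr_mult_bounds[OF p2 q3, of "0.8023788822504" "0.8023788822513"] by simp
  have p4: "4 powr (- s) \<in> {0.7574262466121..0.7574262466132}"
    using powr_mult_bounds[OF p2 p2, of "0.7574262466121" "0.7574262466132"] by simp
  have p5: "5 powr (- s) \<in> {0.7242999993497..0.7242999993510}"
    using powr_mult_bounds[OF p4 q5, of "0.7242999993497" "0.7242999993510"] by simp
  have p6: "6 powr (- s) \<in> {0.6983122573280..0.6983122573293}"
    using powr_mult_bounds[OF p2 p3, of "0.6983122573280" "0.6983122573293"] by simp
  have p7: "7 powr (- s) \<in> {0.6770687498462..0.6770687498477}"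
    using powr_mult_bounds[OF p6 q7, of "0.6770687498462" "0.6770687498477"] by simp
  have p8: "8 powr (- s) \<in> {0.6591898711837..0.6591898711852}"
    using powr_mult_bounds[OF p2 p4, of "0.6591898711837" "0.6591898711852"] by simp
  have p9: "9 powr (- s) \<in> {0.6438118706814..0.6438118706829}"
    using powr_mult_bounds[OF p3 p3, of "0.6438118706814" "0.6438118706829"] by simp
  have p10: "10 powr (- s) \<in> {0.6303600190847..0.6303600190864}"
    using powr_mult_bounds[OF p2 p5, of "0.6303600190847" "0.6303600190864"] by simp
  have p11: "11 powr (- s) \<in> {0.6184336275930..0.6184336275949}"
    using powr_mult_bounds[OF p10 q11, of "0.6184336275930" "0.6184336275949"] by simp
  have p12: "12 powr (- s) \<in> {0.6077428251437..0.6077428251453}"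
    using powr_mult_bounds[OF p2 p6, of "0.6077428251437" "0.6077428251453"] by simp
  have p13: "13 powr (- s) \<in> {0.5980715174630..0.5980715174648}"
    using powr_mult_bounds[OF p12 q13, of "0.5980715174630" "0.5980715174648"] by simp
  have p14: "14 powr (- s) \<in> {0.5892545498521..0.5892545498539}"
    using powr_mult_bounds[OF p2 p7, of "0.5892545498521" "0.5892545498539"] by simp
  have p15: "15 powr (- s) \<in> {0.5811630238921..0.5811630238939}"
    using powr_mult_bounds[OF p3 p5, of "0.5811630238921" "0.5811630238939"] by simp
  have p16: "16 powr (- s) \<in> {0.5736945190568..0.5736945190586}"
    using powr_mult_bounds[OF p2 p8, of "0.5736945190568" "0.5736945190586"] by simp
  have h11: "(11/2) powr (- s) \<in> {0.7105962664223..0.7105962664238}"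
    using powr_mult_bounds[OF q11 p5, of "0.7105962664223" "0.7105962664238"] by simp
  have h33: "(33/2) powr (- s) \<in> {0.5701674379832..0.5701674379851}"
    using powr_mult_bounds[OF p3 h11, of "0.5701674379832" "0.5701674379851"] by simp
  have "list_all2 (\<ge>) pow_upper (map (\<lambda>i. real (Suc i) powr (- s)) [0..<16])"
    using p2 p3 p4 p5 p6 p7 p8 p9 p10 p11 p12 p13 p14 p15 p16
    by (simp add: pow_upper_def upt_rec)
  from list_all2_nthD2[OF this, of i] show "i < 16 \<Longrightarrow> real (Suc i) powr (- s) \<le> pow_upper ! i" by simp
  show "0.5701674379832 \<le> (33/2) powr (- s)" using h33 by simp
qed

section \<open>Rational enclosures of tail ratios and of even zeta values\<close>

lemma sum_lessThan_unroll:
  fixes f :: "nat \<Rightarrow> real"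
  shows "(\<Sum>k<2. f k) = f 0 + f 1"
    and "(\<Sum>k<3. f k) = f 0 + f 1 + f 2"
    and "(\<Sum>k<4. f k) = f 0 + f 1 + f 2 + f 3"
    and "(\<Sum>k<6. f k) = f 0 + f 1 + f 2 + f 3 + f 4 + f 5"
    and "(\<Sum>k<8. f k) = f 0 + f 1 + f 2 + f 3 + f 4 + f 5 + f 6 + f 7"
    and "(\<Sum>k<15. f k) = f 0 + f 1 + f 2 + f 3 + f 4 + f 5 + f 6 + f 7 + f 8 + f 9 + f 10 + f 11 + f 12 + f 13 + f 14"
    and "(\<Sum>k<16. f k) = f 0 + f 1 + f 2 + f 3 + f 4 + f 5 + f 6 + f 7 + f 8 + f 9 + f 10 + f 11 + f 12 + f 13 + f 14 + f 15"
  by (simp_all add: eval_nat_numeral)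

lemma upt_16: "[0..<16] = [0, 1, 2, 3, 4, 5, 6, 7, 8, 9, 10, 11, 12, 13, 14, 15]"
  by (simp add: upt_rec numeral_eq_Suc)

text \<open>Backward recursion: the ratio at x + 2j enters the relation at x with the small factor
  (4/1089)^j, so a crude enclosure at 8 sharpens at 6, 4 and 2.\<close>

lemma tail_ratio_even_bounds:
  shows tail_ratio_8: "tail_ratio 8 \<in> {0.9908943089430..1}"
    and tail_ratio_6: "tail_ratio 6 \<in> {0.9953964230058..0.9954504393529}"
    and tail_ratio_4: "tail_ratio 4 \<in> {0.9981692753692..0.9981694007508}"
    and tail_ratio_2: "tail_ratio 2 \<in> {0.9996943011261..0.9996943012847}"
proof -
  show r8: "tail_ratio 8 \<in> {0.9908943089430..1}"
    using tail_ratio_expand_1[of 8] tail_ratio_bounds[of 8] by simp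
  show r6: "tail_ratio 6 \<in> {0.9953964230058..0.9954504393529}"
    using tail_ratio_expand_2[of 6] r8 by (simp add: power_divide)
  show r4: "tail_ratio 4 \<in> {0.9981692753692..0.9981694007508}"
    using tail_ratio_expand_3[of 4] r6 r8 by (simp add: power_divide)
  show r2: "tail_ratio 2 \<in> {0.9996943011261..0.9996943012847}"
    using tail_ratio_expand_3[of 2] r4 r6 by (simp add: power_divide)
qed

text \<open>Entry \<open>i\<close> of the lists belongs to the summation index \<open>n = i + 1\<close>; all decimals are rounded outwards.\<close>
definition excess_lower :: "real list" where
  "excess_lower =
   [0.6449340668465, 0.0823232337075, 0.0173430619779, 0.0040773561976, 0.0009945751266,
    0.0002460865518, 0.0000612481347, 0.0000152822590, 0.0000038172929, 0.0000009539620,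
    0.0000002384504, 0.0000000596081, 0.0000000149015, 0.0000000037252, 0.0000000009313,
    0.0000000002328]"

definition excess_upper :: "real list" where
  "excess_upper =
   [0.6449340668562, 0.0823232337169, 0.0173430619869, 0.0040773562016, 0.0009945751279,
    0.0002460865535, 0.0000612481351, 0.0000152822596, 0.0000038172935, 0.0000009539621,
    0.0000002384507, 0.0000000596082, 0.0000000149016, 0.0000000037260, 0.0000000009315,
    0.0000000002329]"

lemma excess_bounds:
  assumes "i < 16"
  shows "excess_lower ! i \<le> zeta_excess i" "zeta_excess i \<le> excess_upper ! i"
proof -
  have c0: "zeta_excess 0 \<in> {0.6449340668465..0.6449340668562}"
    using tail_ratio_2 zeta_excess_rr[of 0] by (simp add: sum_lessThan_unroll power_divide)
  have c1: "zeta_excess 1 \<in> {0.0823232337075..0.0823232337169}"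
    using tail_ratio_4 zeta_excess_rr[of 1] by (simp add: sum_lessThan_unroll power_divide)
  have c2: "zeta_excess 2 \<in> {0.0173430619779..0.0173430619869}"
    using tail_ratio_6 zeta_excess_rr[of 2] by (simp add: sum_lessThan_unroll power_divide)
  have c3: "zeta_excess 3 \<in> {0.0040773561976..0.0040773562016}"
    using tail_ratio_8 zeta_excess_rr[of 3] by (simp add: sum_lessThan_unroll power_divide)
  \<comment> \<open>From zeta(10) on, the tail after the chosen number of explicit terms fits into
    the interval, so the partial sum and the midpoint bound suffice.\<close>
  have c4: "zeta_excess 4 \<in> {0.0009945751266..0.0009945751279}"
    using zeta_excess_ge_partial[where m = 15 and n = 4] zeta_excess_upper[where m = 15 and n = 4]
    by (simp add: sum_lessThan_unroll power_divide)
  have c5: "zeta_excess 5 \<in> {0.0002460865518..0.0002460865535}"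
    using zeta_excess_ge_partial[where m = 8 and n = 5] zeta_excess_upper[where m = 8 and n = 5]
    by (simp add: sum_lessThan_unroll power_divide)
  have c6: "zeta_excess 6 \<in> {0.0000612481347..0.0000612481351}"
    using zeta_excess_ge_partial[where m = 6 and n = 6] zeta_excess_upper[where m = 6 and n = 6]
    by (simp add: sum_lessThan_unroll power_divide)
  have c7: "zeta_excess 7 \<in> {0.0000152822590..0.0000152822596}"
    using zeta_excess_ge_partial[where m = 4 and n = 7] zeta_excess_upper[where m = 4 and n = 7]
    by (simp add: sum_lessThan_unroll power_divide)
  have c8: "zeta_excess 8 \<in> {0.0000038172929..0.0000038172935}"
    using zeta_excess_ge_partial[where m = 3 and n = 8] zeta_excess_upper[where m = 3 and n = 8]
    by (simp add: sum_lessThan_unroll power_divide)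
  have c9: "zeta_excess 9 \<in> {0.0000009539620..0.0000009539621}"
    using zeta_excess_ge_partial[where m = 3 and n = 9] zeta_excess_upper[where m = 3 and n = 9]
    by (simp add: sum_lessThan_unroll power_divide)
  have c10: "zeta_excess 10 \<in> {0.0000002384504..0.0000002384507}"
    using zeta_excess_ge_partial[where m = 2 and n = 10] zeta_excess_upper[where m = 2 and n = 10]
    by (simp add: sum_lessThan_unroll power_divide)
  have c11: "zeta_excess 11 \<in> {0.0000000596081..0.0000000596082}"
    using zeta_excess_ge_partial[where m = 2 and n = 11] zeta_excess_upper[where m = 2 and n = 11]
    by (simp add: sum_lessThan_unroll power_divide)
  have c12: "zeta_excess 12 \<in> {0.0000000149015..0.0000000149016}"
    using zeta_excess_ge_partial[where m = 2 and n = 12] zeta_excess_upper[where m = 2 and n = 12]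
    by (simp add: sum_lessThan_unroll power_divide)
  have c13: "zeta_excess 13 \<in> {0.0000000037252..0.0000000037260}"
    using zeta_excess_ge_partial[where m = 1 and n = 13] zeta_excess_upper[where m = 1 and n = 13]
    by (simp add: sum_lessThan_unroll power_divide)
  have c14: "zeta_excess 14 \<in> {0.0000000009313..0.0000000009315}"
    using zeta_excess_ge_partial[where m = 1 and n = 14] zeta_excess_upper[where m = 1 and n = 14]
    by (simp add: sum_lessThan_unroll power_divide)
  have c15: "zeta_excess 15 \<in> {0.0000000002328..0.0000000002329}"
    using zeta_excess_ge_partial[where m = 1 and n = 15] zeta_excess_upper[where m = 1 and n = 15]
    by (simp add: sum_lessThan_unroll power_divide)
  have "list_all2 (\<le>) excess_lower (map zeta_excess [0..<16])"
    using c0 c1 c2 c3 c4 c5 c6 c7 c8 c9 c10 c11 c12 c13 c14 c15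
    by (simp add: excess_lower_def upt_16)
  from list_all2_nthD2[OF this, of i] show "excess_lower ! i \<le> zeta_excess i" using assms by simp
  have "list_all2 (\<ge>) excess_upper (map zeta_excess [0..<16])"
    using c0 c1 c2 c3 c4 c5 c6 c7 c8 c9 c10 c11 c12 c13 c14 c15
    by (simp add: excess_upper_def upt_16)
  from list_all2_nthD2[OF this, of i] show "zeta_excess i \<le> excess_upper ! i" using assms by simp
qed

text \<open>Backward recursion along s + 6, s + 4, s + 2. At s itself the coefficients for j \<ge> 1
  are negative, which pushes the ratio slightly above 1.\<close>

lemma tail_ratio_upper:
  assumes s: "s = 200411339/1000000000"
  shows "tail_ratio s \<le> 1.0000245181147"
proof -
  have e: "s + 2 + 2 = s + 4" "s + 2 + 4 = s + 6" "s + 4 + 2 = s + 6" by simp_all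
  have r6: "tail_ratio (s + 6) \<in> {0.9948844987448..1}"
    using tail_ratio_expand_1[of "s + 6"] tail_ratio_bounds[of "s + 6"] by (simp add: s power_divide)
  have r4: "tail_ratio (s + 4) \<in> {0.9979395050677..0.9979531257777}"
    using tail_ratio_expand_2[of "s + 4", unfolded e] r6 by (simp add: s power_divide)
  have r2: "tail_ratio (s + 2) \<in> {0.9995963232952..0.9995963302547}"
    using tail_ratio_expand_3[of "s + 2", unfolded e] r4 r6 by (simp add: s power_divide)
  show ?thesis
    using tail_ratio_expand_unit[of s] r2 r4 by (simp add: s power_divide)
qed

lemma tail_ratio_lower:
  assumes s: "s = 10020567/50000000"
  shows "1.0000245181115 \<le> tail_ratio s"
proof -
  have e: "s + 2 + 2 = s + 4" "s + 2 + 4 = s + 6" "s + 4 + 2 = s + 6" by simp_all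
  have r6: "tail_ratio (s + 6) \<in> {0.9948844987429..1}"
    using tail_ratio_expand_1[of "s + 6"] tail_ratio_bounds[of "s + 6"] by (simp add: s power_divide)
  have r4: "tail_ratio (s + 4) \<in> {0.9979395050665..0.9979531257766}"
    using tail_ratio_expand_2[of "s + 4", unfolded e] r6 by (simp add: s power_divide)
  have r2: "tail_ratio (s + 2) \<in> {0.9995963232947..0.9995963302541}"
    using tail_ratio_expand_3[of "s + 2", unfolded e] r4 r6 by (simp add: s power_divide)
  show ?thesis
    using tail_ratio_expand_unit[of s] r2 r4 by (simp add: s power_divide)
qed

section \<open>The signs at the two ends and the zero between them\<close>

lemma D_pos_at_left_end:
  assumes s: "s = 200411339/1000000000"
  shows "zeta1_re s / (s - 1) + E_re s > 0"
proof -
  have s0: "0 \<le> s" and s1: "s < 1" by (simp_all add: s)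
  have "(\<Sum>i<16. (1 + excess_lower ! i) * pow_lower ! i) \<le> (\<Sum>i<16. (1 + zeta_excess i) * real (Suc i) powr (- s))"
  proof (rule sum_mono)
    fix i assume "i \<in> {..<16::nat}"
    hence i: "i < 16" by simp
    have "length pow_lower = 16" "\<forall>q\<in>set pow_lower. 0 \<le> q" by (simp_all add: pow_lower_def)
    hence "0 \<le> pow_lower ! i" using i by simp
    thus "(1 + excess_lower ! i) * pow_lower ! i \<le> (1 + zeta_excess i) * real (Suc i) powr (- s)"
      using excess_bounds[OF i] pow_lower_bounds(1)[OF s i] zeta_excess_nonneg[of i]
      by (intro mult_mono) auto
  qed
  moreover have "tail_ratio s * (33/2) * (33/2) powr (- s) / (1 - s) \<le> 1.0000245181147 * (33/2) * 0.5701674395834 / (1 - s)"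
    using tail_ratio_upper[OF s] pow_lower_bounds(2)[OF s] by (intro divide_right_mono mult_mono) (auto simp: s)
  \<comment> \<open>Both sides are near 11.77 and differ by less than 10^(-8); this cancellation
    dictates the 13 decimals of the enclosures.\<close>
  moreover have "1.0000245181147 * (33/2) * 0.5701674395834 / (1 - s) < (\<Sum>i<16. (1 + excess_lower ! i) * pow_lower ! i)"
    by (simp add: s sum_lessThan_unroll excess_lower_def pow_lower_def)
  ultimately show ?thesis
    using D_decomposition[OF s1] E_re_tail(1)[OF s0] by linarith
qed

lemma D_neg_at_right_end:
  assumes s: "s = 10020567/50000000"
  shows "zeta1_re s / (s - 1) + E_re s < 0"
proof -
  have s0: "0 \<le> s" and s1: "s < 1" by (simp_all add: s)
  have "(\<Sum>i<16. (1 + zeta_excess i) * real (Suc i) powr (- s)) \<le> (\<Sum>i<16. (1 + excess_upper ! i) * pow_upper ! i)"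
  proof (rule sum_mono)
    fix i assume "i \<in> {..<16::nat}"
    hence i: "i < 16" by simp
    show "(1 + zeta_excess i) * real (Suc i) powr (- s) \<le> (1 + excess_upper ! i) * pow_upper ! i"
      using excess_bounds[OF i] pow_upper_bounds(1)[OF s i] zeta_excess_nonneg[of i]
      by (intro mult_mono) auto
  qed
  moreover have "1.0000245181115 * (33/2) * 0.5701674379832 / (1 - s) \<le> tail_ratio s * (33/2) * (33/2) powr (- s) / (1 - s)"
    using tail_ratio_lower[OF s] pow_upper_bounds(2)[OF s] by (intro divide_right_mono mult_mono) (auto simp: s)
  \<comment> \<open>The summand \<open>excess_upper ! 15 / 3\<close> covers the terms n > 16 of E,
    which cannot be dropped from an upper bound.\<close>
  moreover have "(\<Sum>i<16. (1 + excess_upper ! i) * pow_upper ! i) + excess_upper ! 15 / 3 < 1.0000245181115 * (33/2) * 0.5701674379832 / (1 - s)"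
    by (simp add: s sum_lessThan_unroll excess_upper_def pow_upper_def)
  moreover have "zeta_excess 15 \<le> excess_upper ! 15" by (rule excess_bounds) simp
  ultimately show ?thesis
    using D_decomposition[OF s1] E_re_tail(2)[OF s0] by linarith
qed

theorem proposition4p2:
  shows "(\<forall>\<sigma>::real. \<sigma> \<noteq> 1 \<longrightarrow> D_fun (of_real \<sigma>) \<in> \<real>) \<and>
         (\<forall>\<sigma>::real. \<sigma> \<le> 0 \<or> \<sigma> > 1 \<longrightarrow> Re (D_fun (of_real \<sigma>)) > 0) \<and>
         filterlim (\<lambda>\<sigma>::real. Re (D_fun (of_real \<sigma>))) at_bot (at_left 1) \<and>
         (\<exists>\<rho>\<^sub>0::real. 0 < \<rho>\<^sub>0 \<and> \<rho>\<^sub>0 < 1 \<and> D_fun (of_real \<rho>\<^sub>0) = 0 \<and>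
            0.200411339 \<le> \<rho>\<^sub>0 \<and> \<rho>\<^sub>0 < 0.200411340)"
proof (intro conjI allI impI)
  fix \<sigma> :: real
  show "\<sigma> \<noteq> 1 \<Longrightarrow> D_fun (of_real \<sigma>) \<in> \<real>"
    by (subst D_fun_of_real) auto
next
  fix \<sigma> :: real
  assume "\<sigma> \<le> 0 \<or> \<sigma> > 1"
  thus "Re (D_fun (of_real \<sigma>)) > 0"
    using D_pos_nonpos[of "- \<sigma>"] D_pos_gt_1[of \<sigma>] D_fun_of_real[of \<sigma>] by auto
next
  have "filterlim (\<lambda>\<sigma>::real. Re (D_fun (of_real \<sigma>))) at_bot (at_left 1) \<longleftrightarrow>
      filterlim (\<lambda>\<sigma>. zeta1_re \<sigma> / (\<sigma> - 1) + E_re \<sigma>) at_bot (at_left 1)"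
    by (rule filterlim_cong[OF refl refl]) (auto simp: eventually_at_filter D_fun_of_real)
  thus "filterlim (\<lambda>\<sigma>::real. Re (D_fun (of_real \<sigma>))) at_bot (at_left 1)"
    by (rule iffD2) (rule D_at_left_1)
next
  define f where "f = (\<lambda>\<sigma>. zeta1_re \<sigma> / (\<sigma> - 1) + E_re \<sigma>)"
  have f: "f (200411339/1000000000) > 0" "f (10020567/50000000) < 0"
    unfolding f_def by (rule D_pos_at_left_end D_neg_at_right_end; simp)+
  have "continuous_on {200411339/1000000000..10020567/50000000} f"
    unfolding f_def by (rule continuous_on_subset[OF continuous_on_D]) auto
  with f obtain \<rho> where \<rho>: "200411339/1000000000 \<le> \<rho>" "\<rho> \<le> 10020567/50000000" "f \<rho> = 0"
    using IVT2'[of f "10020567/50000000" 0 "200411339/1000000000"] by auto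
  \<comment> \<open>The intermediate value theorem yields a closed interval; strict negativity at
    the right end gives the strict upper inequality.\<close>
  have "\<rho> \<noteq> 10020567/50000000" using f(2) \<rho>(3) by (metis less_irrefl)
  moreover have "D_fun (of_real \<rho>) = 0"
    using \<rho> by (subst D_fun_of_real) (auto simp: f_def)
  ultimately show "\<exists>\<rho>\<^sub>0::real. 0 < \<rho>\<^sub>0 \<and> \<rho>\<^sub>0 < 1 \<and> D_fun (of_real \<rho>\<^sub>0) = 0 \<and>
            0.200411339 \<le> \<rho>\<^sub>0 \<and> \<rho>\<^sub>0 < 0.200411340"
    using \<rho> by (intro exI[of _ \<rho>]) auto
qed

end
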